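(* Suppose that, for every round $j\in T$, the round-$j$ profile $P^j$ is single-peaked with respect to a given candidate axis. The axes may differ across rounds. Then all-rank-wJR and all-rank-wPJR can be verified in polynomial time.
   Context: Model. Voters $V=[n]$, a set $C$ of $m$ candidates, rounds $T=\{1,\dots,|T|\}$ with $n,m,|T|\ge1$. In each round $j$ each voter $i$ has a strict complete ranking of $C$; $P^j$ is the tuple of round-$j$ rankings and $P=(P^1,\dots,P^{|T|})$ is the profile. $P^j$ is single-peaked with respect to a linear order (axis) of $C$ if, for every voter, candidates are ranked lower as one moves away from her first choice along the axis in either direction. For $r\in[m]$, $A_i^j(r)$ is the set of voter $i$'s $r$ most-preferred candidates in round $j$. A sequence is $W=(w^1,\dots,w^{|T|})\in C^{|T|}$. A group is a nonempty $S\subseteq V$. Verification problem for an axiom: given a profile $P$ (here together with the axes) and a sequence $W$, decide whether $W$ satisfies the axiom. Axioms. Under a rank matrix $R=(r_i^j)\in[m]^{|T|\times n}$, a group $S$ agrees in round $j$ if $\bigcap_{i\in S}A_i^j(r_i^j)\ne\varnothing$ and is represented in round $j$ if $w^j\in\bigcup_{i\in S}A_i^j(r_i^j)$. All-rank-wPJR: for every rank matrix $R$, every positive integer $\ell$, and every group $S$ that agrees in every round under $R$ with $|S|\ge\ell n/|T|$, $S$ is represented in at least $\ell$ rounds. All-rank-wJR: for every rank matrix $R$, every group $S$ that agrees in every round under $R$ with $|S|\ge n/|T|$ is represented in at least one round. *)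

theory Defs
  imports Complex_Main "HOL-Library.Log_Nat" "HOL-Computational_Algebra.Polynomial"
begin

section \<open>Elections over rounds\<close>

text \<open>
  Voters are \<open>0, \<dots>, n - 1\<close> and rounds are \<open>0, \<dots>, T - 1\<close>. A strict complete ranking of a finite
  candidate set is the list of all candidates without repetition, most preferred first; a linear
  order serving as axis is represented in the same way. \<open>P j i\<close> is the ranking of voter \<open>i\<close> in
  round \<open>j\<close>.
\<close>

type_synonym 'c profile = "nat \<Rightarrow> nat \<Rightarrow> 'c list"

definition linear_order_list :: "'c set \<Rightarrow> 'c list \<Rightarrow> bool" where
  "linear_order_list C xs \<longleftrightarrow> distinct xs \<and> set xs = C"

definition precedes :: "'c list \<Rightarrow> 'c \<Rightarrow> 'c \<Rightarrow> bool" where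
  "precedes xs x y \<longleftrightarrow> (\<exists>p q. p < q \<and> q < length xs \<and> xs ! p = x \<and> xs ! q = y)"

definition single_peaked_ranking :: "'c list \<Rightarrow> 'c list \<Rightarrow> bool" where
  "single_peaked_ranking axis ranking \<longleftrightarrow>
     (\<forall>p k q. p < length axis \<longrightarrow> axis ! p = hd ranking \<longrightarrow>
        p \<le> k \<and> k < q \<and> q < length axis \<or> q < k \<and> k \<le> p \<longrightarrow>
        precedes ranking (axis ! k) (axis ! q))"

definition single_peaked :: "nat \<Rightarrow> 'c list \<Rightarrow> (nat \<Rightarrow> 'c list) \<Rightarrow> bool" where
  "single_peaked n axis Q \<longleftrightarrow> (\<forall>i<n. single_peaked_ranking axis (Q i))"

definition top_set :: "'c profile \<Rightarrow> nat \<Rightarrow> nat \<Rightarrow> nat \<Rightarrow> 'c set" where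
  "top_set P i j r = set (take r (P j i))"

definition rank_matrix :: "nat \<Rightarrow> nat \<Rightarrow> nat \<Rightarrow> (nat \<Rightarrow> nat \<Rightarrow> nat) \<Rightarrow> bool" where
  "rank_matrix n m T R \<longleftrightarrow> (\<forall>j<T. \<forall>i<n. R j i \<in> {1..m})"

definition group_of :: "nat \<Rightarrow> nat set \<Rightarrow> bool" where
  "group_of n S \<longleftrightarrow> S \<noteq> {} \<and> S \<subseteq> {..<n}"

definition agrees :: "'c profile \<Rightarrow> (nat \<Rightarrow> nat \<Rightarrow> nat) \<Rightarrow> nat set \<Rightarrow> nat \<Rightarrow> bool" where
  "agrees P R S j \<longleftrightarrow> (\<Inter>i\<in>S. top_set P i j (R j i)) \<noteq> {}"

definition represented ::
  "'c profile \<Rightarrow> (nat \<Rightarrow> nat \<Rightarrow> nat) \<Rightarrow> (nat \<Rightarrow> 'c) \<Rightarrow> nat set \<Rightarrow> nat \<Rightarrow> bool" where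
  "represented P R W S j \<longleftrightarrow> W j \<in> (\<Union>i\<in>S. top_set P i j (R j i))"

definition all_rank_wPJR ::
  "nat \<Rightarrow> nat \<Rightarrow> nat \<Rightarrow> 'c profile \<Rightarrow> (nat \<Rightarrow> 'c) \<Rightarrow> bool" where
  "all_rank_wPJR n m T P W \<longleftrightarrow>
     (\<forall>R l S. rank_matrix n m T R \<longrightarrow> 1 \<le> l \<longrightarrow> group_of n S \<longrightarrow>
        (\<forall>j<T. agrees P R S j) \<longrightarrow> real (card S) \<ge> real l * real n / real T \<longrightarrow>
        l \<le> card {j. j < T \<and> represented P R W S j})"

definition all_rank_wJR ::
  "nat \<Rightarrow> nat \<Rightarrow> nat \<Rightarrow> 'c profile \<Rightarrow> (nat \<Rightarrow> 'c) \<Rightarrow> bool" where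
  "all_rank_wJR n m T P W \<longleftrightarrow>
     (\<forall>R S. rank_matrix n m T R \<longrightarrow> group_of n S \<longrightarrow>
        (\<forall>j<T. agrees P R S j) \<longrightarrow> real (card S) \<ge> real n / real T \<longrightarrow>
        (\<exists>j<T. represented P R W S j))"


section \<open>Instances of the verification problem\<close>

text \<open>As problem inputs, candidates are numbered \<open>0, \<dots>, m - 1\<close>.\<close>

record election =
  num_voters :: nat
  num_cands :: nat
  num_rounds :: nat
  prof :: "nat profile"
  axes :: "nat \<Rightarrow> nat list"
  winners :: "nat \<Rightarrow> nat"

definition single_peaked_election :: "election \<Rightarrow> bool" where
  "single_peaked_election E \<longleftrightarrow>
     num_voters E \<ge> 1 \<and> num_cands E \<ge> 1 \<and> num_rounds E \<ge> 1 \<and>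
     (\<forall>j<num_rounds E.
        (\<forall>i<num_voters E. linear_order_list {..<num_cands E} (prof E j i)) \<and>
        linear_order_list {..<num_cands E} (axes E j) \<and>
        single_peaked (num_voters E) (axes E j) (prof E j) \<and>
        winners E j < num_cands E)"

definition encode_election :: "election \<Rightarrow> nat list" where
  "encode_election E =
     [num_voters E, num_cands E, num_rounds E]
     @ concat (map (\<lambda>j. concat (map (prof E j) [0..<num_voters E])) [0..<num_rounds E])
     @ concat (map (axes E) [0..<num_rounds E])
     @ map (winners E) [0..<num_rounds E]"


section \<open>Polynomial time\<close>

text \<open>
  Time is measured on a random access machine programmed in a While language. The memory consists
  of arrays of natural numbers named by strings (a scalar is entry 0 of an array); a program mentions
  only finitely many of them. The only arithmetic operations are addition and truncated subtraction.
  Each assignment and each test costs one unit; the number of operations inside an expression is a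
  constant of the program. As there is no multiplication, the bit length of the largest number in
  memory grows by at most a constant per step, so this unit-cost measure is polynomially related to
  Turing machine time.
\<close>

type_synonym state = "string \<Rightarrow> nat \<Rightarrow> nat"

datatype aexp = Const nat | Read string aexp | Plus aexp aexp | Minus aexp aexp

fun aval :: "aexp \<Rightarrow> state \<Rightarrow> nat" where
  "aval (Const k) s = k"
| "aval (Read x a) s = s x (aval a s)"
| "aval (Plus a b) s = aval a s + aval b s"
| "aval (Minus a b) s = aval a s - aval b s"

datatype com =
    Skip
  | Write string aexp aexp
  | Seq com com
  | If aexp com com
  | While aexp com

text \<open>
  \<open>exec c s t s'\<close>: started in \<open>s\<close>, the program \<open>c\<close> terminates in \<open>s'\<close> after \<open>t\<close> time units.
  \<open>Write x a b\<close> is the assignment \<open>x[a] := b\<close>; a test succeeds iff its value is nonzero.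
\<close>

inductive exec :: "com \<Rightarrow> state \<Rightarrow> nat \<Rightarrow> state \<Rightarrow> bool" where
  exec_Skip: "exec Skip s 1 s"
| exec_Write: "exec (Write x a b) s 1 (s(x := (s x)(aval a s := aval b s)))"
| exec_Seq: "exec c s t s' \<Longrightarrow> exec d s' u s'' \<Longrightarrow> exec (Seq c d) s (t + u) s''"
| exec_IfTrue: "aval a s \<noteq> 0 \<Longrightarrow> exec c s t s' \<Longrightarrow> exec (If a c d) s (1 + t) s'"
| exec_IfFalse: "aval a s = 0 \<Longrightarrow> exec d s t s' \<Longrightarrow> exec (If a c d) s (1 + t) s'"
| exec_WhileFalse: "aval a s = 0 \<Longrightarrow> exec (While a c) s 1 s"
| exec_WhileTrue: "aval a s \<noteq> 0 \<Longrightarrow> exec c s t s' \<Longrightarrow> exec (While a c) s' u s'' \<Longrightarrow>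
    exec (While a c) s (1 + t + u) s''"

inductive_cases exec_SkipE: "exec Skip s t s'"
inductive_cases exec_WriteE: "exec (Write x a b) s t s'"
inductive_cases exec_SeqE: "exec (Seq c d) s t s'"
inductive_cases exec_IfE: "exec (If a c d) s t s'"
inductive_cases exec_WhileE: "exec (While a c) s t s'"

lemma exec_deterministic:
  "exec c s t s' \<Longrightarrow> exec c s u s'' \<Longrightarrow> u = t \<and> s'' = s'"
proof (induction arbitrary: u s'' rule: exec.induct)
  case exec_Skip
  then show ?case by (rule exec_SkipE) simp
next
  case exec_Write
  then show ?case by (rule exec_WriteE) simp
next
  case exec_Seq
  from exec_Seq.prems show ?case by (rule exec_SeqE) (metis exec_Seq.IH)
next
  case exec_IfTrue
  from exec_IfTrue.prems show ?case
    by (rule exec_IfE) (metis exec_IfTrue.IH exec_IfTrue.hyps(1) not_gr_zero plus_1_eq_Suc add_Suc)+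
next
  case exec_IfFalse
  from exec_IfFalse.prems show ?case
    by (rule exec_IfE) (metis exec_IfFalse.IH exec_IfFalse.hyps(1) not_gr_zero plus_1_eq_Suc add_Suc)+
next
  case exec_WhileFalse
  from exec_WhileFalse.prems show ?case
    by (rule exec_WhileE) (simp_all add: exec_WhileFalse.hyps)
next
  case exec_WhileTrue
  from exec_WhileTrue.prems show ?case
    by (rule exec_WhileE) (metis exec_WhileTrue.IH exec_WhileTrue.hyps(1) not_gr_zero plus_1_eq_Suc add_Suc)+
qed

definition initial_state :: "nat list \<Rightarrow> state" where
  "initial_state xs = (\<lambda>x k.
     if x = ''input'' \<and> k < length xs then xs ! k
     else if x = ''length'' \<and> k = 0 then length xs
     else 0)"

definition accepting :: "state \<Rightarrow> bool" where
  "accepting s \<longleftrightarrow> s ''output'' 0 \<noteq> 0"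

text \<open>\<open>floorlog 2 x\<close> is the number of binary digits of \<open>x\<close>; one more unit per entry is a separator.\<close>

definition input_size :: "nat list \<Rightarrow> nat" where
  "input_size xs = (\<Sum>x\<leftarrow>xs. floorlog 2 x + 1)"

text \<open>
  A decision problem with a promise: inputs are the encodings of the objects satisfying \<open>promise\<close>,
  and nothing is required of the program on other memory contents.
\<close>

definition poly_time_decidable ::
  "('x \<Rightarrow> nat list) \<Rightarrow> ('x \<Rightarrow> bool) \<Rightarrow> ('x \<Rightarrow> bool) \<Rightarrow> bool" where
  "poly_time_decidable encode promise property \<longleftrightarrow>
     (\<exists>(c :: com) (q :: nat poly). \<forall>x. promise x \<longrightarrow>
        (\<exists>t s'. exec c (initial_state (encode x)) t s' \<and>
                t \<le> poly q (input_size (encode x)) \<and>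
                (accepting s' \<longleftrightarrow> property x)))"

end

theory Submission
  imports Defs
begin

text \<open>
  A group can be unrepresented in a round while agreeing there iff its members have a common
  candidate they all prefer to the winner. On a single-peaked axis this means that the peaks of all
  members lie strictly on the same side of the winner. Once a member \<open>h\<close> is fixed, each round thus
  has a prescribed side, and voter \<open>i\<close> either fits in round \<open>j\<close> or does not. All-rank-wJR fails iff
  for some \<open>h\<close> at least \<open>n / T\<close> voters fit in every round. All-rank-wPJR fails iff for some \<open>h\<close> there
  is \<open>S\<close> with \<open>T * card S \<ge> n * (card (N S) + 1)\<close>, where \<open>N S\<close> consists of the rounds in which some
  member of \<open>S\<close> does not fit. By Hall's theorem with deficiency, this says that a maximum assignment
  of \<open>T\<close> tokens per voter to \<open>n\<close> slots per round, along the edges of misfits, leaves at least \<open>n\<close>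
  tokens unplaced. Such an assignment is computed by an auction, in which unplaced tokens bid for
  their cheapest slots and each bid raises a price by one; a price level that does not occur
  separates a Hall violator.
\<close>

section \<open>Loop programs\<close>

definition upd :: "state \<Rightarrow> string \<Rightarrow> nat \<Rightarrow> nat \<Rightarrow> state" where
  "upd s x k v = s(x := (s x)(k := v))"

lemma upd_same [simp]: "upd s x k v x = (s x)(k := v)"
  and upd_other [simp]: "y \<noteq> x \<Longrightarrow> upd s x k v y = s y"
  by (simp_all add: upd_def)

definition holds :: "aexp \<Rightarrow> state \<Rightarrow> bool" where
  "holds b s \<longleftrightarrow> aval b s \<noteq> 0"

definition Neg :: "aexp \<Rightarrow> aexp" where
  "Neg a = Minus (Const 1) a"

text \<open>The truncated difference \<open>a - (a - b)\<close> is the minimum of \<open>a\<close> and \<open>b\<close>.\<close>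

definition And :: "aexp \<Rightarrow> aexp \<Rightarrow> aexp" where
  "And a b = Minus a (Minus a b)"

definition Or :: "aexp \<Rightarrow> aexp \<Rightarrow> aexp" where
  "Or a b = Plus a b"

definition Less :: "aexp \<Rightarrow> aexp \<Rightarrow> aexp" where
  "Less a b = Minus b a"

definition Eq :: "aexp \<Rightarrow> aexp \<Rightarrow> aexp" where
  "Eq a b = Neg (Or (Less a b) (Less b a))"

lemma holds_simps [simp]:
  "holds (Neg a) s \<longleftrightarrow> \<not> holds a s"
  "holds (And a b) s \<longleftrightarrow> holds a s \<and> holds b s"
  "holds (Or a b) s \<longleftrightarrow> holds a s \<or> holds b s"
  "holds (Less a b) s \<longleftrightarrow> aval a s < aval b s"
  "holds (Eq a b) s \<longleftrightarrow> aval a s = aval b s"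
  by (auto simp: holds_def Neg_def And_def Or_def Less_def Eq_def)

lemma holds_Read [simp]: "holds (Read x a) s \<longleftrightarrow> s x (aval a s) \<noteq> 0"
  by (simp add: holds_def)

abbreviation Var :: "string \<Rightarrow> aexp" where
  "Var x \<equiv> Read x (Const 0)"

datatype prog =
    Nop
  | Assign string aexp aexp
  | Block prog prog (infixr \<open>;;\<close> 60)
  | Cond aexp prog prog
  | Loop string prog

text \<open>The length of the input is the only loop bound, which makes the running time of every program
  polynomial.\<close>

primrec iterate :: "(nat \<Rightarrow> 'a \<Rightarrow> 'a) \<Rightarrow> nat \<Rightarrow> 'a \<Rightarrow> 'a" where
  "iterate f 0 s = s"
| "iterate f (Suc k) s = f k (iterate f k s)"

text \<open>The final \<open>upd\<close> in the loop case leaves the counter at the value with which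
  the compiled while loop exits.\<close>

primrec run :: "prog \<Rightarrow> state \<Rightarrow> state" where
  "run Nop s = s"
| "run (Assign x a b) s = upd s x (aval a s) (aval b s)"
| "run (p ;; q) s = run q (run p s)"
| "run (Cond b p q) s = (if holds b s then run p s else run q s)"
| "run (Loop x p) s =
     upd (iterate (\<lambda>k t. run p (upd t x 0 k)) (s ''length'' 0) s) x 0 (s ''length'' 0)"

primrec writes :: "prog \<Rightarrow> string set" where
  "writes Nop = {}"
| "writes (Assign x a b) = {x}"
| "writes (p ;; q) = writes p \<union> writes q"
| "writes (Cond b p q) = writes p \<union> writes q"
| "writes (Loop x p) = insert x (writes p)"

text \<open>A body that touches neither its counter nor \<open>length\<close> turns the while loop
  produced by \<open>compile\<close> into a bounded loop.\<close>

primrec proper :: "prog \<Rightarrow> bool" where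
  "proper Nop \<longleftrightarrow> True"
| "proper (Assign x a b) \<longleftrightarrow> x \<noteq> ''length''"
| "proper (p ;; q) \<longleftrightarrow> proper p \<and> proper q"
| "proper (Cond b p q) \<longleftrightarrow> proper p \<and> proper q"
| "proper (Loop x p) \<longleftrightarrow> proper p \<and> x \<notin> writes p \<and> x \<noteq> ''length''"

primrec compile :: "prog \<Rightarrow> com" where
  "compile Nop = Skip"
| "compile (Assign x a b) = Write x a b"
| "compile (p ;; q) = Seq (compile p) (compile q)"
| "compile (Cond b p q) = com.If b (compile p) (compile q)"
| "compile (Loop x p) = Seq (Write x (Const 0) (Const 0))
     (While (Less (Var x) (Var ''length''))
        (Seq (compile p) (Write x (Const 0) (Plus (Var x) (Const 1)))))"

text \<open>A polynomial in the input length. For a conditional, the sum of both branches stands in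
  for their maximum. A loop pays two units for the initialisation and the failing last test, and two
  per pass for the test and the increment.\<close>

primrec cost :: "prog \<Rightarrow> nat poly" where
  "cost Nop = [:1:]"
| "cost (Assign x a b) = [:1:]"
| "cost (p ;; q) = cost p + cost q"
| "cost (Cond b p q) = [:1:] + cost p + cost q"
| "cost (Loop x p) = [:2:] + [:0, 1:] * ([:2:] + cost p)"

section \<open>Correctness and running time of compiled programs\<close>

lemma poly_cost_mono: "k \<le> l \<Longrightarrow> poly (cost p) k \<le> poly (cost p) l"
  by (induction p) (auto intro!: add_mono mult_mono)

lemma run_frame: "x \<notin> writes p \<Longrightarrow> run p s x = s x"
proof (induction p arbitrary: s)
  case (Loop y p)
  have "iterate (\<lambda>k t. run p (upd t y 0 k)) l s x = s x" for l
    using Loop by (induction l) auto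
  then show ?case using Loop.prems by simp
qed auto

lemma proper_length: "proper p \<Longrightarrow> ''length'' \<notin> writes p"
  by (induction p) auto

lemma exec_compile:
  assumes "proper p"
  shows "\<exists>t \<le> poly (cost p) (s ''length'' 0). exec (compile p) s t (run p s)"
  using assms
proof (induction p arbitrary: s)
  case Nop
  then show ?case by (auto intro!: exI[of _ 1] exec_Skip[simplified])
next
  case (Assign x a b)
  have "exec (compile (Assign x a b)) s 1 (run (Assign x a b) s)"
    unfolding run.simps compile.simps upd_def by (rule exec_Write)
  moreover have "1 \<le> poly (cost (Assign x a b)) (s ''length'' 0)"
    by simp
  ultimately show ?case by blast
next
  case (Block p q)
  obtain t where t: "t \<le> poly (cost p) (s ''length'' 0)" "exec (compile p) s t (run p s)"
    using Block by auto
  obtain u where u: "u \<le> poly (cost q) (run p s ''length'' 0)"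
    "exec (compile q) (run p s) u (run q (run p s))"
    using Block by auto
  have "run p s ''length'' 0 = s ''length'' 0"
    using Block.prems by (simp add: run_frame proper_length)
  then show ?case using t u exec_Seq[OF t(2) u(2)]
    by (intro exI[of _ "t + u"]) auto
next
  case (Cond b p q)
  show ?case
  proof (cases "holds b s")
    case True
    obtain t where "t \<le> poly (cost p) (s ''length'' 0)" "exec (compile p) s t (run p s)"
      using Cond by auto
    then show ?thesis using True
      by (auto simp: holds_def intro!: exI[of _ "1 + t"] exec_IfTrue[simplified])
  next
    case False
    obtain t where "t \<le> poly (cost q) (s ''length'' 0)" "exec (compile q) s t (run q s)"
      using Cond by auto
    then show ?thesis using False
      by (auto simp: holds_def intro!: exI[of _ "1 + t"] exec_IfFalse[simplified])
  qed
next
  case (Loop x p)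
  define L where "L = s ''length'' 0"
  define f where "f = (\<lambda>k t. run p (upd t x 0 k))"
  \<comment> \<open>\<open>st k\<close> is the state at the while test before pass \<open>k\<close>:
    there the compiled code has already advanced the counter to \<open>k\<close>, whereas
    \<open>iterate\<close> sets it only when the pass begins.\<close>
  define st where "st k = upd (iterate f k s) x 0 k" for k
  define body where "body = Seq (compile p) (Write x (Const 0) (Plus (Var x) (Const 1)))"
  have frame: "iterate f k s ''length'' = s ''length''" for k
    using Loop.prems proper_length[of p] by (induction k) (auto simp: f_def run_frame)
  have body: "\<exists>t \<le> 1 + poly (cost p) L. exec body (st k) t (st (Suc k))" for k
  proof -
    obtain t where t: "t \<le> poly (cost p) (st k ''length'' 0)"
      "exec (compile p) (st k) t (run p (st k))"
      using Loop by auto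
    have "run p (st k) x 0 = k"
      using Loop.prems by (simp add: run_frame st_def)
    then have "exec body (st k) (t + 1) (st (Suc k))"
      using exec_Seq[OF t(2) exec_Write[of x "Const 0" "Plus (Var x) (Const 1)"]]
      by (simp add: body_def st_def f_def upd_def)
    moreover have "st k ''length'' 0 = L"
      using Loop.prems frame by (auto simp: st_def L_def)
    ultimately show ?thesis using t(1) by (intro exI[of _ "t + 1"]) auto
  qed
  \<comment> \<open>Induction on the number of passes left. The summand \<open>1\<close> pays for
    the failing last test, the summand \<open>2\<close> for the test and the increment of each
    pass.\<close>
  have "k \<le> L \<Longrightarrow> \<exists>t \<le> 1 + (L - k) * (2 + poly (cost p) L).
      exec (While (Less (Var x) (Var ''length'')) body) (st k) t (st L)" for k
  proof (induction "L - k" arbitrary: k)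
    case 0
    then have "aval (Less (Var x) (Var ''length'')) (st k) = 0" "k = L"
      using Loop.prems frame by (auto simp: st_def L_def Less_def)
    then show ?case using exec_WhileFalse by force
  next
    case (Suc d)
    have *: "aval (Less (Var x) (Var ''length'')) (st k) \<noteq> 0"
      using Loop.prems frame Suc(2) by (auto simp: st_def L_def Less_def)
    obtain t where t: "t \<le> 1 + poly (cost p) L" "exec body (st k) t (st (Suc k))"
      using body by blast
    have "d = L - Suc k" "Suc k \<le> L" using Suc(2) by auto
    then obtain u where u: "u \<le> 1 + (L - Suc k) * (2 + poly (cost p) L)"
      "exec (While (Less (Var x) (Var ''length'')) body) (st (Suc k)) u (st L)"
      using Suc(1) by blast
    have "L - k = Suc (L - Suc k)" using Suc(2) by simp
    then have "1 + t + u \<le> 1 + (L - k) * (2 + poly (cost p) L)"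
      using t(1) u(1) by simp
    then show ?case using exec_WhileTrue[OF * t(2) u(2)] by blast
  qed
  from this[of 0] obtain t where t: "t \<le> 1 + L * (2 + poly (cost p) L)"
    "exec (While (Less (Var x) (Var ''length'')) body) (st 0) t (st L)"
    by auto
  have "exec (compile (Loop x p)) s (1 + t) (st L)"
    using exec_Seq[OF exec_Write[of x "Const 0" "Const 0" s], of _ t "st L"] t(2)
    by (simp add: st_def upd_def body_def)
  moreover have "st L = run (Loop x p) s"
    by (simp add: st_def f_def L_def)
  ultimately show ?case using t(1)
    by (intro exI[of _ "1 + t"]) (simp add: L_def)
qed

text \<open>Invariant rule. The premise \<open>indep\<close> is there because the counter is
  overwritten at the start of each pass and after the last one. The step may assume that everything
  outside \<open>writes\<close> is unchanged since \<open>s\<close>, so an invariant needs to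
  mention only what the loop modifies.\<close>

lemma Loop_rule:
  assumes "proper (Loop x p)" and "I 0 s"
    and indep: "\<And>k t v. I k t \<Longrightarrow> I k (upd t x 0 v)"
    and step: "\<And>k t. k < s ''length'' 0 \<Longrightarrow> I k t \<Longrightarrow> t x 0 = k \<Longrightarrow>
      (\<forall>y. y \<notin> writes (Loop x p) \<longrightarrow> t y = s y) \<Longrightarrow> I (Suc k) (run p t)"
  shows "I (s ''length'' 0) (run (Loop x p) s)"
proof -
  define f where "f = (\<lambda>k t. run p (upd t x 0 k))"
  have "k \<le> s ''length'' 0 \<Longrightarrow>
      I k (iterate f k s) \<and> (\<forall>y. y \<notin> writes (Loop x p) \<longrightarrow> iterate f k s y = s y)" for k
  proof (induction k)
    case 0
    then show ?case using assms by simp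
  next
    case (Suc k)
    then have *: "I k (iterate f k s)" "\<forall>y. y \<notin> writes (Loop x p) \<longrightarrow> iterate f k s y = s y"
      by auto
    show ?case
      using step[of k "upd (iterate f k s) x 0 k"] indep[OF *(1)] *(2) Suc.prems
      by (auto simp: f_def run_frame)
  qed
  from this[of "s ''length'' 0"] show ?thesis
    using indep by (simp add: f_def)
qed

lemma length_le_input_size: "length xs \<le> input_size xs"
  by (induction xs) (auto simp: input_size_def)

text \<open>The cost bound is monotone in the number of entries, and each entry contributes at least
  one unit to \<open>input_size\<close>.\<close>

lemma poly_time_decidable_run:
  assumes "proper p"
    and "\<And>x. promise x \<Longrightarrow>
      run p (initial_state (encode x)) ''output'' 0 \<noteq> 0 \<longleftrightarrow> property x"
  shows "poly_time_decidable encode promise property"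
  unfolding poly_time_decidable_def
proof (intro exI[of _ "compile p"] exI[of _ "cost p"] allI impI)
  fix x assume x: "promise x"
  let ?s = "initial_state (encode x)"
  obtain t where t: "t \<le> poly (cost p) (?s ''length'' 0)" "exec (compile p) ?s t (run p ?s)"
    using exec_compile[OF assms(1)] by blast
  have "?s ''length'' 0 = length (encode x)" by (simp add: initial_state_def)
  then have "t \<le> poly (cost p) (input_size (encode x))"
    using t(1) poly_cost_mono[OF length_le_input_size] by (metis le_trans)
  then show "\<exists>t s'. exec (compile p) ?s t s' \<and>
      t \<le> poly (cost p) (input_size (encode x)) \<and> (accepting s' \<longleftrightarrow> property x)"
    using t(2) assms(2)[OF x] unfolding accepting_def by blast
qed

section \<open>Common candidates and sides of the winner\<close>

lemma precedes_asym:
  assumes "distinct xs" "precedes xs x y" "precedes xs y x"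
  shows False
  using assms unfolding precedes_def
  by (metis distinct_conv_nth less_trans nat_less_le)

text \<open>Connects preferences with the top sets of rank matrices: cutting the ranking at the
  position of \<open>y\<close> keeps exactly the candidates above it.\<close>

lemma precedes_take_iff:
  assumes "distinct xs" "x \<in> set xs" "y \<in> set xs"
  shows "precedes xs x y \<longleftrightarrow> (\<exists>r. x \<in> set (take r xs) \<and> y \<notin> set (take r xs))"
proof
  assume "precedes xs x y"
  then obtain p q where "p < q" "q < length xs" "xs ! p = x" "xs ! q = y"
    by (auto simp: precedes_def)
  then show "\<exists>r. x \<in> set (take r xs) \<and> y \<notin> set (take r xs)"
    using assms(1) by (intro exI[of _ q]) (force simp: set_conv_nth distinct_conv_nth)
next
  assume "\<exists>r. x \<in> set (take r xs) \<and> y \<notin> set (take r xs)"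
  then obtain r where r: "x \<in> set (take r xs)" "y \<notin> set (take r xs)" by blast
  obtain p where p: "p < r" "p < length xs" "xs ! p = x" using r(1) by (auto simp: set_conv_nth)
  obtain q where q: "q < length xs" "xs ! q = y" using assms(3) by (auto simp: set_conv_nth)
  have "\<not> q < r" using r(2) q by (force simp: set_conv_nth)
  then show "precedes xs x y" using p q unfolding precedes_def
    by (intro exI[of _ p] exI[of _ q]) auto
qed

definition position :: "'a list \<Rightarrow> 'a \<Rightarrow> nat" where
  "position xs x = length (takeWhile (\<lambda>y. y \<noteq> x) xs)"

lemma position:
  assumes "x \<in> set xs"
  shows "position xs x < length xs" "xs ! position xs x = x"
proof -
  show *: "position xs x < length xs"
    using assms unfolding position_def by (induction xs) auto
  show "xs ! position xs x = x"
    using nth_length_takeWhile[of "\<lambda>y. y \<noteq> x" xs] * by (simp add: position_def)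
qed

lemma position_eq_iff:
  assumes "distinct xs" "x \<in> set xs" "k < length xs"
  shows "xs ! k = x \<longleftrightarrow> k = position xs x"
  using assms position[OF assms(2)] by (metis nth_eq_iff_index_eq)

section \<open>Elections that are single-peaked in every round\<close>

locale single_peaked_instance =
  fixes E :: election and n m T :: nat and P :: "nat profile" and W :: "nat \<Rightarrow> nat"
  assumes promise: "single_peaked_election E"
  defines "n \<equiv> num_voters E" and "m \<equiv> num_cands E" and "T \<equiv> num_rounds E"
    and "P \<equiv> prof E" and "W \<equiv> winners E"
begin

lemma pos: "n \<ge> 1" "m \<ge> 1" "T \<ge> 1"
  using promise by (auto simp: single_peaked_election_def n_def m_def T_def)

lemma ranking:
  assumes "j < T" "i < n"
  shows "distinct (P j i)" "set (P j i) = {..<m}" "length (P j i) = m"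
proof -
  show *: "distinct (P j i)" "set (P j i) = {..<m}"
    using promise assms
    by (auto simp: single_peaked_election_def linear_order_list_def n_def m_def T_def P_def)
  show "length (P j i) = m" using distinct_card[OF *(1)] *(2) by simp
qed

lemma axis:
  assumes "j < T"
  shows "distinct (axes E j)" "set (axes E j) = {..<m}" "length (axes E j) = m"
proof -
  show *: "distinct (axes E j)" "set (axes E j) = {..<m}"
    using promise assms
    by (auto simp: single_peaked_election_def linear_order_list_def m_def T_def)
  show "length (axes E j) = m" using distinct_card[OF *(1)] *(2) by simp
qed

lemma winner: "j < T \<Longrightarrow> W j < m"
  using promise by (auto simp: single_peaked_election_def m_def T_def W_def)

definition winner_pos :: "nat \<Rightarrow> nat" where
  "winner_pos j = position (axes E j) (W j)"

definition peak_pos :: "nat \<Rightarrow> nat \<Rightarrow> nat" where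
  "peak_pos j i = position (axes E j) (hd (P j i))"

lemma winner_pos: "j < T \<Longrightarrow> winner_pos j < m" "j < T \<Longrightarrow> axes E j ! winner_pos j = W j"
  using position[of "W j" "axes E j"] axis winner by (auto simp: winner_pos_def)

lemma peak_pos:
  assumes "j < T" "i < n"
  shows "peak_pos j i < m" "axes E j ! peak_pos j i = hd (P j i)"
proof -
  have "hd (P j i) \<in> set (axes E j)"
    using ranking[OF assms] axis[OF assms(1)] pos by (metis hd_in_set length_greater_0_conv less_le_trans zero_less_one)
  then show "peak_pos j i < m" "axes E j ! peak_pos j i = hd (P j i)"
    using position[of "hd (P j i)" "axes E j"] axis[OF assms(1)] by (auto simp: peak_pos_def)
qed

lemma farther_ranked_lower:
  assumes "j < T" "i < n" "q < m" "peak_pos j i \<le> k \<and> k < q \<or> q < k \<and> k \<le> peak_pos j i"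
  shows "precedes (P j i) (axes E j ! k) (axes E j ! q)"
proof -
  have "single_peaked_ranking (axes E j) (P j i)"
    using promise assms
    by (auto simp: single_peaked_election_def single_peaked_def n_def T_def P_def)
  then show ?thesis
    using assms peak_pos[OF assms(1,2)] axis[OF assms(1)] unfolding single_peaked_ranking_def by blast
qed

text \<open>Expresses, without a rank matrix, that \<open>S\<close> can agree in round
  \<open>j\<close> and be unrepresented there.\<close>

definition common_preferred :: "nat set \<Rightarrow> nat \<Rightarrow> bool" where
  "common_preferred S j \<longleftrightarrow> (\<exists>c<m. \<forall>i\<in>S. precedes (P j i) c (W j))"

text \<open>The neighbour of the winner on the side of the peaks is preferred by all of \<open>S\<close> as soon as
  any candidate is.\<close>

lemma common_preferred_iff:
  assumes "j < T" "S \<subseteq> {..<n}" "S \<noteq> {}"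
  shows "common_preferred S j \<longleftrightarrow>
    (\<forall>i\<in>S. peak_pos j i < winner_pos j) \<or> (\<forall>i\<in>S. winner_pos j < peak_pos j i)"
proof
  assume "common_preferred S j"
  then obtain c where c: "c < m" "\<And>i. i \<in> S \<Longrightarrow> precedes (P j i) c (W j)"
    by (auto simp: common_preferred_def)
  define q where "q = position (axes E j) c"
  have q: "q < m" "axes E j ! q = c"
    using position[of c "axes E j"] axis[OF assms(1)] c(1) by (auto simp: q_def)
  have no: "\<not> precedes (P j i) (W j) c" if "i \<in> S" for i
    using precedes_asym[OF ranking(1)[OF assms(1), of i] c(2)[OF that]] that assms(2) by auto
  have "q \<noteq> winner_pos j"
    using c(2) no assms(3) winner_pos[OF assms(1)] q by auto
  \<comment> \<open>With the peak at the winner or beyond, the winner would lie between the peak and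
    \<open>c\<close>, and single-peakedness would rank it above \<open>c\<close>.\<close>
  moreover have "peak_pos j i < winner_pos j" if "q < winner_pos j" "i \<in> S" for i
  proof (rule ccontr)
    assume "\<not> ?thesis"
    then have "precedes (P j i) (axes E j ! winner_pos j) (axes E j ! q)"
      using that assms q by (intro farther_ranked_lower) auto
    then show False using no[OF that(2)] q winner_pos(2)[OF assms(1)] by simp
  qed
  moreover have "winner_pos j < peak_pos j i" if "winner_pos j < q" "i \<in> S" for i
  proof (rule ccontr)
    assume "\<not> ?thesis"
    then have "precedes (P j i) (axes E j ! winner_pos j) (axes E j ! q)"
      using that assms q by (intro farther_ranked_lower) auto
    then show False using no[OF that(2)] q winner_pos(2)[OF assms(1)] by simp
  qed
  ultimately show "(\<forall>i\<in>S. peak_pos j i < winner_pos j) \<or> (\<forall>i\<in>S. winner_pos j < peak_pos j i)"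
    by (meson linorder_neqE_nat)
next
  have neighbour: "common_preferred S j"
    if k: "k < m" and between: "\<forall>i\<in>S. peak_pos j i \<le> k \<and> k < winner_pos j \<or> winner_pos j < k \<and> k \<le> peak_pos j i" for k
  proof -
    have "axes E j ! k < m" using axis[OF assms(1)] k by (metis lessThan_iff nth_mem)
    moreover have "precedes (P j i) (axes E j ! k) (W j)" if "i \<in> S" for i
      using farther_ranked_lower[of j i "winner_pos j" k] that assms winner_pos[OF assms(1)]
        between by auto
    ultimately show ?thesis by (auto simp: common_preferred_def)
  qed
  obtain i0 where i0: "i0 \<in> S" using assms(3) by blast
  assume "(\<forall>i\<in>S. peak_pos j i < winner_pos j) \<or> (\<forall>i\<in>S. winner_pos j < peak_pos j i)"
  then show "common_preferred S j"
  proof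
    assume *: "\<forall>i\<in>S. peak_pos j i < winner_pos j"
    \<comment> \<open>The peak of \<open>i0\<close> lies to the left of the winner, so a left
      neighbour exists and the subtraction below is not truncated.\<close>
    then have "0 < winner_pos j" using i0 by fastforce
    then show ?thesis
      using winner_pos(1)[OF assms(1)] * by (intro neighbour[of "winner_pos j - 1"]) auto
  next
    assume *: "\<forall>i\<in>S. winner_pos j < peak_pos j i"
    have "i0 < n" using i0 assms(2) by auto
    then have "Suc (winner_pos j) < m"
      using peak_pos(1)[OF assms(1)] * i0 by (meson Suc_leI order_le_less_trans)
    then show ?thesis
      using * by (intro neighbour[of "Suc (winner_pos j)"]) auto
  qed
qed

text \<open>The candidate witnessing agreement is in the top set of every member and the winner in
  none, so every member ranks the former above the latter.\<close>

lemma agreeing_unrepresented_common_preferred: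
  assumes "j < T" "S \<subseteq> {..<n}" "S \<noteq> {}" "agrees P R S j" "\<not> represented P R W S j"
  shows "common_preferred S j"
proof -
  obtain c where c: "\<And>i. i \<in> S \<Longrightarrow> c \<in> set (take (R j i) (P j i))"
    using assms(4) by (auto simp: agrees_def top_set_def)
  have w: "W j \<notin> set (take (R j i) (P j i))" if "i \<in> S" for i
    using assms(5) that by (auto simp: represented_def top_set_def)
  have r: "set (P j i) = {..<m}" "distinct (P j i)" if "i \<in> S" for i
    using ranking[of j i] assms(1,2) that by auto
  have cm: "c < m" using assms(3) c r by (metis all_not_in_conv in_set_takeD lessThan_iff)
  then show ?thesis
    unfolding common_preferred_def using c w r winner[OF assms(1)]
    by (intro exI[of _ c]) (auto simp: precedes_take_iff)
qed

text \<open>One matrix serves all rounds at once. Where a common preferred candidate exists, each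
  member's ranking is cut between it and the winner; elsewhere everybody gets rank \<open>m\<close>,
  which makes the group agree at the price of being represented.\<close>

lemma rank_matrix_avoiding_winners:
  assumes "S \<subseteq> {..<n}"
  obtains R where "rank_matrix n m T R" "\<And>j. j < T \<Longrightarrow> agrees P R S j"
    "\<And>j. j < T \<Longrightarrow> common_preferred S j \<Longrightarrow> \<not> represented P R W S j"
proof -
  \<comment> \<open>The chosen \<open>c\<close> depends on \<open>S\<close> and \<open>j\<close> but
    not on the outer \<open>i\<close>, so all members are cut below one and the same
    candidate.\<close>
  define R where "R j i = (if common_preferred S j \<and> i \<in> S
      then SOME r. r \<le> m \<and> (SOME c. c < m \<and> (\<forall>i\<in>S. precedes (P j i) c (W j))) \<in> set (take r (P j i))
        \<and> W j \<notin> set (take r (P j i)) else m)" for j i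
  have R: "\<exists>c. \<forall>i\<in>S. R j i \<le> m \<and> c \<in> set (take (R j i) (P j i)) \<and> W j \<notin> set (take (R j i) (P j i))"
    if "j < T" "common_preferred S j" for j
  proof -
    define c where "c = (SOME c. c < m \<and> (\<forall>i\<in>S. precedes (P j i) c (W j)))"
    have c: "c < m" "\<forall>i\<in>S. precedes (P j i) c (W j)"
      using someI_ex[of "\<lambda>c. c < m \<and> (\<forall>i\<in>S. precedes (P j i) c (W j))"] that(2)
      by (auto simp: common_preferred_def c_def)
    have "R j i \<le> m \<and> c \<in> set (take (R j i) (P j i)) \<and> W j \<notin> set (take (R j i) (P j i))"
      if iS: "i \<in> S" for i
    proof -
      have i: "i < n" using iS assms by auto
      note r = ranking[OF \<open>j < T\<close> i]
      obtain r where "c \<in> set (take r (P j i))" "W j \<notin> set (take r (P j i))"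
        using c iS precedes_take_iff[of "P j i" c "W j"] r winner[OF \<open>j < T\<close>] by auto
      \<comment> \<open>A rank above \<open>m\<close> gives the whole list, as \<open>m\<close>
        does, so capping at \<open>m\<close> does not change the top set.\<close>
      then have "\<exists>r\<le>m. c \<in> set (take r (P j i)) \<and> W j \<notin> set (take r (P j i))"
        using r(3) by (intro exI[of _ "min r m"]) (cases "r \<le> m", auto simp: min_def)
      from someI_ex[OF this] show ?thesis using iS \<open>common_preferred S j\<close> by (simp add: R_def c_def)
    qed
    then show ?thesis by blast
  qed
  show ?thesis
  proof
    show "rank_matrix n m T R" unfolding rank_matrix_def
    proof (intro allI impI)
      fix j i assume "j < T" "i < n"
      show "R j i \<in> {1..m}"
      proof (cases "common_preferred S j \<and> i \<in> S")
        case True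
        then obtain c where "R j i \<le> m \<and> c \<in> set (take (R j i) (P j i))" using R \<open>j < T\<close> by blast
        \<comment> \<open>Rank \<open>0\<close> is excluded because its top set is empty and cannot
          contain \<open>c\<close>.\<close>
        then show ?thesis by (cases "R j i") auto
      next
        case False
        then show ?thesis using pos by (auto simp: R_def)
      qed
    qed
    show "agrees P R S j" if "j < T" for j
    proof (cases "common_preferred S j")
      case True
      then show ?thesis using R[OF that] by (auto simp: agrees_def top_set_def)
    next
      case False
      \<comment> \<open>With rank \<open>m\<close> every candidate is common to the group; candidate
        \<open>0\<close> exists because \<open>m\<close> is positive.\<close>
      have "0 \<in> top_set P i j (R j i)" if "i \<in> S" for i
        using False ranking[OF \<open>j < T\<close>, of i] that assms pos by (auto simp: top_set_def R_def)
      then show ?thesis by (auto simp: agrees_def)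
    qed
    show "\<not> represented P R W S j" if "j < T" "common_preferred S j" for j
      using R[OF that] by (auto simp: represented_def top_set_def)
  qed
qed

text \<open>The reference voter \<open>h\<close> fixes one of the two sides in each round. If the
  peak of \<open>h\<close> is the winner itself, nobody is compatible in that round, not even
  \<open>h\<close>.\<close>

definition compatible :: "nat \<Rightarrow> nat \<Rightarrow> nat \<Rightarrow> bool" where
  "compatible h i j \<longleftrightarrow>
     peak_pos j h < winner_pos j \<and> peak_pos j i < winner_pos j \<or>
     winner_pos j < peak_pos j h \<and> winner_pos j < peak_pos j i"

lemma common_preferred_compatible:
  assumes "j < T" "S \<subseteq> {..<n}" "h \<in> S"
  shows "common_preferred S j \<longleftrightarrow> (\<forall>i\<in>S. compatible h i j)"
proof -
  have "S \<noteq> {}" using assms(3) by blast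
  show ?thesis
    unfolding common_preferred_iff[OF assms(1,2) \<open>S \<noteq> {}\<close>] compatible_def using assms(3)
    by (cases "peak_pos j h < winner_pos j"; cases "winner_pos j < peak_pos j h") auto
qed

text \<open>Here \<open>h\<close> merely names a side for each round and may lie outside
  \<open>S\<close>, so the characterisations below can let \<open>h\<close> and \<open>S\<close>
  range independently.\<close>

lemma compatible_common_preferred:
  assumes "j < T" "S \<subseteq> {..<n}" "S \<noteq> {}" "\<forall>i\<in>S. compatible h i j"
  shows "common_preferred S j"
  unfolding common_preferred_iff[OF assms(1-3)]
  using assms(4) unfolding compatible_def
  by (cases "peak_pos j h < winner_pos j"; cases "winner_pos j < peak_pos j h") auto

section \<open>Combinatorial characterisations of the two axioms\<close>

lemma ge_div_iff: "real a \<ge> real b / real T \<longleftrightarrow> b \<le> T * a"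
proof -
  have "real a \<ge> real b / real T \<longleftrightarrow> real b \<le> real (T * a)"
    using pos by (simp add: field_simps)
  then show ?thesis using of_nat_le_iff by blast
qed

text \<open>An agreeing group that contains \<open>h\<close> and is never represented consists of
  voters compatible with \<open>h\<close> in every round. The set of all these voters is itself such
  a group if it is nonempty, so only its size matters.\<close>

lemma all_rank_wJR_iff:
  "all_rank_wJR n m T P W \<longleftrightarrow>
     (\<forall>h<n. T * card {i. i < n \<and> (\<forall>j<T. compatible h i j)} < n)"
proof
  assume wJR: "all_rank_wJR n m T P W"
  show "\<forall>h<n. T * card {i. i < n \<and> (\<forall>j<T. compatible h i j)} < n"
  proof (rule ccontr)
    assume "\<not> ?thesis"
    then obtain h where h: "T * card {i. i < n \<and> (\<forall>j<T. compatible h i j)} \<ge> n"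
      by (auto simp: not_less)
    define S where "S = {i. i < n \<and> (\<forall>j<T. compatible h i j)}"
    have S: "S \<subseteq> {..<n}" "S \<noteq> {}" using h pos(1) by (auto simp: S_def[symmetric]) (auto simp: S_def)
    obtain R where R: "rank_matrix n m T R" "\<And>j. j < T \<Longrightarrow> agrees P R S j"
      "\<And>j. j < T \<Longrightarrow> common_preferred S j \<Longrightarrow> \<not> represented P R W S j"
      using rank_matrix_avoiding_winners[OF S(1)] by blast
    have "common_preferred S j" if "j < T" for j
      using compatible_common_preferred[OF that S] that by (auto simp: S_def)
    moreover have "\<exists>j<T. represented P R W S j"
      using wJR R(1,2) S h ge_div_iff[of n "card S"]
      unfolding all_rank_wJR_def group_of_def S_def[symmetric] by simp
    ultimately show False using R(3) by blast
  qed
next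
  assume *: "\<forall>h<n. T * card {i. i < n \<and> (\<forall>j<T. compatible h i j)} < n"
  show "all_rank_wJR n m T P W"
    unfolding all_rank_wJR_def
  proof (intro allI impI, rule ccontr)
    fix R S
    assume R: "rank_matrix n m T R" "group_of n S" "\<forall>j<T. agrees P R S j"
      "real (card S) \<ge> real n / real T" "\<not> (\<exists>j<T. represented P R W S j)"
    then have S: "S \<subseteq> {..<n}" "S \<noteq> {}" by (auto simp: group_of_def)
    then obtain h where h: "h \<in> S" by blast
    have "compatible h i j" if "i \<in> S" "j < T" for i j
      using agreeing_unrepresented_common_preferred[OF that(2) S, of R]
        common_preferred_compatible[OF that(2) S(1) h] R(3,5) that by blast
    then have "card S \<le> card {i. i < n \<and> (\<forall>j<T. compatible h i j)}"
      using S by (intro card_mono) auto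
    then have "T * card S \<le> T * card {i. i < n \<and> (\<forall>j<T. compatible h i j)}" by simp
    moreover have "T * card {i. i < n \<and> (\<forall>j<T. compatible h i j)} < n" using * h S(1) by auto
    moreover have "n \<le> T * card S" using R(4) ge_div_iff by blast
    ultimately show False by linarith
  qed
qed

text \<open>A suitable matrix confines the representation of \<open>S\<close> to the rounds with a
  misfit, and when \<open>h\<close> belongs to \<open>S\<close> each of those rounds is forced.
  Hence the smallest demand that can fail is one more than their number, and it requires the
  smallest group.\<close>

lemma all_rank_wPJR_iff:
  "all_rank_wPJR n m T P W \<longleftrightarrow>
     (\<forall>h<n. \<forall>S\<subseteq>{..<n}. T * card S < n * (card {j. j < T \<and> (\<exists>i\<in>S. \<not> compatible h i j)} + 1))"
proof
  assume wPJR: "all_rank_wPJR n m T P W"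
  show "\<forall>h<n. \<forall>S\<subseteq>{..<n}. T * card S < n * (card {j. j < T \<and> (\<exists>i\<in>S. \<not> compatible h i j)} + 1)"
  proof (rule ccontr)
    assume "\<not> ?thesis"
    then obtain h S where S: "S \<subseteq> {..<n}"
      and big: "T * card S \<ge> n * (card {j. j < T \<and> (\<exists>i\<in>S. \<not> compatible h i j)} + 1)"
      by (auto simp: not_less)
    define J where "J = {j. j < T \<and> (\<exists>i\<in>S. \<not> compatible h i j)}"
    \<comment> \<open>For empty \<open>S\<close> the left side of \<open>big\<close> is
      \<open>0\<close> and the right side at least \<open>n\<close>.\<close>
    have "S \<noteq> {}" using big pos by auto
    obtain R where R: "rank_matrix n m T R" "\<And>j. j < T \<Longrightarrow> agrees P R S j"
      "\<And>j. j < T \<Longrightarrow> common_preferred S j \<Longrightarrow> \<not> represented P R W S j"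
      using rank_matrix_avoiding_winners[OF S] by blast
    have "real (card S) \<ge> real (card J + 1) * real n / real T"
      using big ge_div_iff[of "(card J + 1) * n" "card S"] by (simp add: J_def algebra_simps)
    then have "card J + 1 \<le> card {j. j < T \<and> represented P R W S j}"
      using wPJR[unfolded all_rank_wPJR_def, rule_format, of R "card J + 1" S] R(1,2) S \<open>S \<noteq> {}\<close>
      by (simp add: group_of_def)
    also have "\<dots> \<le> card J"
    proof (intro card_mono subsetI)
      fix j assume "j \<in> {j. j < T \<and> represented P R W S j}"
      then show "j \<in> J"
        using R(3)[of j] compatible_common_preferred[OF _ S \<open>S \<noteq> {}\<close>, of j h] by (auto simp: J_def)
    qed (simp add: J_def)
    finally show False by simp
  qed
next
  assume *: "\<forall>h<n. \<forall>S\<subseteq>{..<n}. T * card S < n * (card {j. j < T \<and> (\<exists>i\<in>S. \<not> compatible h i j)} + 1)"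
  show "all_rank_wPJR n m T P W"
    unfolding all_rank_wPJR_def
  proof (intro allI impI, rule ccontr)
    fix R l S
    assume R: "rank_matrix n m T R" "1 \<le> l" "group_of n S" "\<forall>j<T. agrees P R S j"
      "real (card S) \<ge> real l * real n / real T"
      "\<not> l \<le> card {j. j < T \<and> represented P R W S j}"
    then have S: "S \<subseteq> {..<n}" "S \<noteq> {}" by (auto simp: group_of_def)
    then obtain h where h: "h \<in> S" by blast
    have "{j. j < T \<and> (\<exists>i\<in>S. \<not> compatible h i j)} \<subseteq> {j. j < T \<and> represented P R W S j}"
    proof safe
      fix j i assume j: "j < T" and i: "i \<in> S" "\<not> compatible h i j"
      show "represented P R W S j"
        using agreeing_unrepresented_common_preferred[OF j S, of R]
          common_preferred_compatible[OF j S(1) h] R(4) i j by blast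
    qed
    then have "card {j. j < T \<and> (\<exists>i\<in>S. \<not> compatible h i j)} \<le> card {j. j < T \<and> represented P R W S j}"
      by (intro card_mono) auto
    \<comment> \<open>The group falls short of \<open>l\<close>, so its size, which suffices for
      \<open>l\<close>, also suffices for the demand one above the number of misfit rounds.\<close>
    then have "card {j. j < T \<and> (\<exists>i\<in>S. \<not> compatible h i j)} + 1 \<le> l"
      using R(6) by simp
    then have "n * (card {j. j < T \<and> (\<exists>i\<in>S. \<not> compatible h i j)} + 1) \<le> n * l"
      using mult_le_mono2 by blast
    also have "\<dots> \<le> T * card S"
      using R(5) ge_div_iff[of "l * n" "card S"] by (simp add: mult.commute)
    finally have "n * (card {j. j < T \<and> (\<exists>i\<in>S. \<not> compatible h i j)} + 1) \<le> T * card S" .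
    moreover have "h < n" using S h by auto
    ultimately show False using * S(1) by (meson leD)
  qed
qed

end

section \<open>An auction for bipartite b-matchings\<close>

text \<open>The argument \<open>z\<close> is an owner entry: \<open>0\<close> marks a free slot, and
  \<open>Suc i\<close> marks voter \<open>i\<close>, who gets one token back.\<close>

definition evict :: "(nat \<Rightarrow> nat) \<Rightarrow> nat \<Rightarrow> nat \<Rightarrow> nat" where
  "evict u z = (if z = 0 then u else u(z - 1 := Suc (u (z - 1))))"

text \<open>Each of the \<open>n\<close> voters has \<open>T\<close> tokens; slot \<open>s < T * n\<close> belongs to round \<open>s div n\<close> and takes one
  token of a voter adjacent to that round. \<open>u i\<close> counts the unplaced tokens of \<open>i\<close>, \<open>ow s\<close> is \<open>0\<close> for a
  free slot and \<open>Suc i\<close> for one held by \<open>i\<close>, and \<open>p s\<close> is the price of \<open>s\<close>.\<close>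

locale auction =
  fixes n T K :: nat and adj :: "nat \<Rightarrow> nat \<Rightarrow> bool"
  assumes n_pos: "n \<ge> 1" and K_large: "T * n < K"
begin

text \<open>The inequality between prices is approximate complementary slackness: a holder pays at
  most one more than its cheapest option. A slot gets its first price increment together with an
  owner and is never freed afterwards, hence the clause on positive prices.\<close>

definition valid :: "(nat \<Rightarrow> nat) \<Rightarrow> (nat \<Rightarrow> nat) \<Rightarrow> (nat \<Rightarrow> nat) \<Rightarrow> bool" where
  "valid u ow p \<longleftrightarrow>
     (\<forall>i<n. u i + card {s. s < T * n \<and> ow s = Suc i} = T) \<and>
     (\<forall>s<T * n. ow s \<le> n) \<and>
     (\<forall>s<T * n. \<forall>i. ow s = Suc i \<longrightarrow> adj i (s div n)) \<and>
     (\<forall>s<T * n. p s > 0 \<longrightarrow> ow s > 0) \<and>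
     (\<forall>s<T * n. \<forall>i r. ow s = Suc i \<longrightarrow> r < T * n \<longrightarrow> adj i (r div n) \<longrightarrow> p s \<le> Suc (p r)) \<and>
     (\<forall>s<T * n. p s \<le> K)"

text \<open>It grows by one with each bid and is bounded through the price cap, which limits the
  number of bids.\<close>

definition potential :: "(nat \<Rightarrow> nat) \<Rightarrow> nat" where
  "potential p = (\<Sum>s<T * n. p s)"

definition eligible :: "(nat \<Rightarrow> nat) \<Rightarrow> (nat \<Rightarrow> nat) \<Rightarrow> nat \<Rightarrow> bool" where
  "eligible u p i \<longleftrightarrow> 0 < u i \<and> (\<exists>s<T * n. adj i (s div n) \<and> p s < K)"

lemma potential_le: "valid u ow p \<Longrightarrow> potential p \<le> T * n * K"
  unfolding potential_def valid_def using sum_bounded_above[of "{..<T * n}" p K] by simp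

lemma card_eq_sum: "card {s. s < (N::nat) \<and> Q s} = (\<Sum>s<N. of_bool (Q s))"
proof -
  have "{s. s < N \<and> Q s} = {..<N} \<inter> Collect Q" by auto
  then show ?thesis by simp
qed

text \<open>Raising the price of \<open>c\<close> only relaxes the slackness condition of the other
  slots, and the new owner satisfies it because \<open>c\<close> was its cheapest option. If
  \<open>i\<close> outbids itself, its token count is unchanged.\<close>

lemma valid_bid:
  assumes v: "valid u ow p" and i: "i < n" "0 < u i" and c: "c < T * n" "adj i (c div n)" "p c < K"
    and cheapest: "\<forall>s<T * n. adj i (s div n) \<longrightarrow> p c \<le> p s"
  shows "valid ((evict u (ow c))(i := evict u (ow c) i - 1)) (ow(c := Suc i)) (p(c := Suc (p c)))"
    and "potential (p(c := Suc (p c))) = Suc (potential p)"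
proof -
  have split: "(\<Sum>s<T * n. f s) = f c + (\<Sum>s\<in>{..<T * n} - {c}. f s)" for f :: "nat \<Rightarrow> nat"
    using c(1) by (intro sum.remove) auto
  show "potential (p(c := Suc (p c))) = Suc (potential p)"
    unfolding potential_def split by simp
  have tokens: "((evict u (ow c))(i := evict u (ow c) i - 1)) k
      + card {s. s < T * n \<and> (ow(c := Suc i)) s = Suc k} = T" if "k < n" for k
  proof -
    have "(\<Sum>s\<in>{..<T * n} - {c}. of_bool ((ow(c := Suc i)) s = Suc k))
        = (\<Sum>s\<in>{..<T * n} - {c}. of_bool (ow s = Suc k) :: nat)"
      by (intro sum.cong) auto
    moreover have "u k + card {s. s < T * n \<and> ow s = Suc k} = T"
      using v that by (auto simp: valid_def)
    ultimately show ?thesis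
      using i unfolding card_eq_sum split evict_def
      by (cases "ow c") auto
  qed
  have "p s \<le> Suc (p r)" if "s < T * n" "ow s = Suc k" "r < T * n" "adj k (r div n)" for s k r
    using v that by (auto simp: valid_def)
  moreover have "p s \<le> Suc ((p(c := Suc (p c))) r)"
    if "s < T * n" "ow s = Suc k" "r < T * n" "adj k (r div n)" for s k r
    using calculation[OF that] by auto
  ultimately show "valid ((evict u (ow c))(i := evict u (ow c) i - 1)) (ow(c := Suc i)) (p(c := Suc (p c)))"
    using v tokens i c cheapest unfolding valid_def by auto
qed

text \<open>Among the \<open>T * n + 1\<close> prices \<open>0, \<dots>, T * n\<close> one does not occur; the voters all of whose slots
  cost more than this gap form a Hall violator.\<close>

lemma violator_iff:
  assumes v: "valid u ow p" and stuck: "\<forall>i<n. \<not> eligible u p i"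
  shows "(\<exists>S\<subseteq>{..<n}. n * (card {j. j < T \<and> (\<exists>i\<in>S. adj i j)} + 1) \<le> T * card S)
    \<longleftrightarrow> n \<le> (\<Sum>i<n. u i)"
proof -
  define nbrs where "nbrs S = {j. j < T \<and> (\<exists>i\<in>S. adj i j)}" for S
  define held where "held S = {s. s < T * n \<and> (\<exists>i\<in>S. ow s = Suc i)}" for S
  \<comment> \<open>Token balance: each token of a member of \<open>S\<close> is either unplaced or
    occupies a slot.\<close>
  have count: "T * card S = (\<Sum>i\<in>S. u i) + card (held S)" if "S \<subseteq> {..<n}" for S
  proof -
    have fin: "finite S" using that finite_subset by blast
    have "card (held S) = card (\<Union>i\<in>S. {s. s < T * n \<and> ow s = Suc i})"
      by (rule arg_cong[of _ _ card]) (auto simp: held_def)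
    also have "\<dots> = (\<Sum>i\<in>S. card {s. s < T * n \<and> ow s = Suc i})"
      using fin by (intro card_UN_disjoint) auto
    finally have "(\<Sum>i\<in>S. u i) + card (held S) = (\<Sum>i\<in>S. u i + card {s. s < T * n \<and> ow s = Suc i})"
      by (simp add: sum.distrib)
    also have "\<dots> = (\<Sum>i\<in>S. T)"
      using v that by (intro sum.cong) (auto simp: valid_def)
    finally show ?thesis by simp
  qed
  \<comment> \<open>Round \<open>j\<close> owns the slots \<open>j * n + k\<close> with
    \<open>k < n\<close>.\<close>
  have slots: "card {s. s < T * n \<and> s div n \<in> J} = n * card J" if "J \<subseteq> {..<T}" for J
  proof -
    have "{s. s < T * n \<and> s div n \<in> J} = (\<lambda>(j, k). j * n + k) ` (J \<times> {..<n})" (is "?A = ?B")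
    proof
      show "?A \<subseteq> ?B"
      proof
        fix s assume "s \<in> ?A"
        then have "s = (\<lambda>(j, k). j * n + k) (s div n, s mod n)" "(s div n, s mod n) \<in> J \<times> {..<n}"
          using n_pos by auto
        then show "s \<in> ?B" by blast
      qed
      have "j * n + k < T * n" if "j < T" "k < n" for j k
        using mult_le_mono1[of "Suc j" T n] that by simp
      then show "?B \<subseteq> ?A" using that n_pos by (auto simp: div_mult_self3)
    qed
    moreover have "inj_on (\<lambda>(j, k). j * n + k) (J \<times> {..<n})"
    proof (rule inj_onI)
      fix x y assume *: "x \<in> J \<times> {..<n}" "y \<in> J \<times> {..<n}"
        and "(\<lambda>(j, k). j * n + k) x = (\<lambda>(j, k). j * n + k) y"
      then have "fst x * n + snd x = fst y * n + snd y" by (simp add: case_prod_beta)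
      then have "(fst x * n + snd x) div n = (fst y * n + snd y) div n"
        "(fst x * n + snd x) mod n = (fst y * n + snd y) mod n"
        by simp_all
      then show "x = y" using * by (auto simp: prod_eq_iff)
    qed
    ultimately show ?thesis by (simp add: card_image card_cartesian_product)
  qed
  have fin_held: "finite (held S)" for S by (simp add: held_def)
  show ?thesis
  proof
    assume "\<exists>S\<subseteq>{..<n}. n * (card {j. j < T \<and> (\<exists>i\<in>S. adj i j)} + 1) \<le> T * card S"
    then obtain S where S: "S \<subseteq> {..<n}" "n * (card (nbrs S) + 1) \<le> T * card S"
      by (auto simp: nbrs_def)
    \<comment> \<open>The placed tokens of \<open>S\<close> fit into the
      \<open>n * card (nbrs S)\<close> slots of adjacent rounds; the violation leaves at least
      \<open>n\<close> tokens over.\<close>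
    have "held S \<subseteq> {s. s < T * n \<and> s div n \<in> nbrs S}"
    proof
      fix s assume "s \<in> held S"
      then obtain i where i: "i \<in> S" "ow s = Suc i" "s < T * n" by (auto simp: held_def)
      then have "adj i (s div n)" using v by (simp add: valid_def)
      then show "s \<in> {s. s < T * n \<and> s div n \<in> nbrs S}"
        using i by (auto simp: nbrs_def less_mult_imp_div_less)
    qed
    then have "card (held S) \<le> card {s. s < T * n \<and> s div n \<in> nbrs S}"
      by (intro card_mono) auto
    also have "\<dots> = n * card (nbrs S)"
      by (intro slots) (auto simp: nbrs_def)
    finally have "n \<le> (\<Sum>i\<in>S. u i)" using S count[OF S(1)] by simp
    also have "\<dots> \<le> (\<Sum>i<n. u i)" using S(1) by (intro sum_mono2) auto
    finally show "n \<le> (\<Sum>i<n. u i)" .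
  next
    assume big: "n \<le> (\<Sum>i<n. u i)"
    have "card (p ` {..<T * n}) < card {..T * n}"
      using card_image_le[of "{..<T * n}" p] by simp
    then have "\<not> {..T * n} \<subseteq> p ` {..<T * n}"
      using card_mono[of "p ` {..<T * n}" "{..T * n}"] by auto
    then obtain g where g: "g \<le> T * n" "\<And>s. s < T * n \<Longrightarrow> p s \<noteq> g" by blast
    define S where "S = {i. i < n \<and> (\<forall>s<T * n. adj i (s div n) \<longrightarrow> g < p s)}"
    have S: "S \<subseteq> {..<n}" by (auto simp: S_def)
    \<comment> \<open>In a stuck state, a voter with an unplaced token sees only slots priced at
      least \<open>K\<close>, and \<open>K\<close> exceeds \<open>T * n\<close> and therefore
      \<open>g\<close>.\<close>
    have "i \<in> S" if "i < n" "u i \<noteq> 0" for i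
      using stuck that g(1) K_large by (force simp: S_def eligible_def)
    then have unplaced: "(\<Sum>i\<in>S. u i) = (\<Sum>i<n. u i)"
      using S by (intro sum.mono_neutral_left) auto
    have "{s. s < T * n \<and> s div n \<in> nbrs S} \<subseteq> held S"
    proof
      fix s assume "s \<in> {s. s < T * n \<and> s div n \<in> nbrs S}"
      then have s: "s < T * n" "g < p s" by (auto simp: nbrs_def S_def)
      then have "ow s > 0" "ow s \<le> n" using v by (auto simp: valid_def)
      then obtain i where i: "ow s = Suc i" "i < n" by (cases "ow s") auto
      \<comment> \<open>By slackness the owner's other options cost at least \<open>p s - 1\<close>,
        hence at least \<open>g\<close>, and no price equals \<open>g\<close>. So the owner is in
        \<open>S\<close>, and \<open>S\<close> holds every slot adjacent to it.\<close>
      have "g < p r" if "r < T * n" "adj i (r div n)" for r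
      proof -
        have "p s \<le> Suc (p r)" using v s(1) i(1) that by (auto simp: valid_def)
        then show ?thesis using s(2) g(2)[OF that(1)] by simp
      qed
      then show "s \<in> held S" using s(1) i by (auto simp: held_def S_def)
    qed
    then have "card {s. s < T * n \<and> s div n \<in> nbrs S} \<le> card (held S)"
      using fin_held by (intro card_mono)
    moreover have "card {s. s < T * n \<and> s div n \<in> nbrs S} = n * card (nbrs S)"
      by (intro slots) (auto simp: nbrs_def)
    ultimately have "n * (card (nbrs S) + 1) \<le> T * card S"
      using count[OF S] unplaced big by simp
    then show "\<exists>S\<subseteq>{..<n}. n * (card {j. j < T \<and> (\<exists>i\<in>S. adj i j)} + 1) \<le> T * card S"
      using S unfolding nbrs_def by blast
  qed
qed

end

section \<open>The verification programs\<close>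

lemma length_concat_uniform:
  assumes "\<And>j. j < t \<Longrightarrow> length (f j) = l"
  shows "length (concat (map f [0..<t])) = t * l"
  using assms by (induction t) auto

lemma nth_concat_uniform:
  assumes "\<And>j. j < t \<Longrightarrow> length (f j) = l" "j < t" "k < l"
  shows "concat (map f [0..<t]) ! (j * l + k) = f j ! k"
  using assms
proof (induction t)
  case (Suc t)
  have len: "length (concat (map f [0..<t])) = t * l"
    using Suc.prems by (intro length_concat_uniform) auto
  show ?case
  proof (cases "j = t")
    case True
    then show ?thesis using len by (simp add: nth_append)
  next
    case False
    then have "j < t" using Suc.prems by simp
    then have "j * l + k < t * l"
      using mult_le_mono1[of "Suc j" t l] Suc.prems(3) by simp
    then show ?thesis using len Suc \<open>j < t\<close> by (simp add: nth_append)
  qed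
qed simp

abbreviation voters_exp :: aexp where "voters_exp \<equiv> Read ''input'' (Const 0)"
abbreviation cands_exp :: aexp where "cands_exp \<equiv> Read ''input'' (Const 1)"
abbreviation rounds_exp :: aexp where "rounds_exp \<equiv> Read ''input'' (Const 2)"

text \<open>Addressing needs products and quotients, which the machine does not offer; they are
  tabulated by repeated addition. The quotient advances exactly when \<open>k + 1\<close> is the
  next multiple of \<open>n\<close>.\<close>

definition tables :: prog where
  "tables = Loop ''k''
     (Assign ''times_n'' (Plus (Var ''k'') (Const 1)) (Plus (Read ''times_n'' (Var ''k'')) voters_exp) ;;
      Assign ''times_m'' (Plus (Var ''k'') (Const 1)) (Plus (Read ''times_m'' (Var ''k'')) cands_exp) ;;
      Cond (Eq (Plus (Var ''k'') (Const 1))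
              (Read ''times_n'' (Plus (Read ''div_n'' (Var ''k'')) (Const 1))))
        (Assign ''div_n'' (Plus (Var ''k'') (Const 1)) (Plus (Read ''div_n'' (Var ''k'')) (Const 1)))
        (Assign ''div_n'' (Plus (Var ''k'') (Const 1)) (Read ''div_n'' (Var ''k''))))"

definition slots_exp :: aexp where
  "slots_exp = Read ''times_n'' rounds_exp"

text \<open>Offsets into \<open>encode_election\<close>: three header entries, then
  \<open>T * n\<close> rankings of length \<open>m\<close>, then the axes, then the winners.\<close>

definition axis_exp :: "aexp \<Rightarrow> aexp \<Rightarrow> aexp" where
  "axis_exp r a = Read ''input'' (Plus (Const 3) (Plus (Read ''times_m'' slots_exp)
     (Plus (Read ''times_m'' r) a)))"

definition winner_exp :: "aexp \<Rightarrow> aexp" where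
  "winner_exp r = Read ''input'' (Plus (Const 3) (Plus (Read ''times_m'' slots_exp)
     (Plus (Read ''times_m'' rounds_exp) r)))"

text \<open>The peak of voter \<open>i\<close> in round \<open>j\<close>, where \<open>s\<close> is \<open>j * n + i\<close>.\<close>

definition peak_exp :: "aexp \<Rightarrow> aexp" where
  "peak_exp s = Read ''input'' (Plus (Const 3) (Read ''times_m'' s))"

text \<open>Exhaustive inversion: \<open>y[x]\<close> receives the \<open>a\<close> that passes the
  test \<open>g\<close>. In \<open>run_search\<close> this \<open>a\<close> is unique, so the entry
  is written just once.\<close>

definition search :: "string \<Rightarrow> aexp \<Rightarrow> aexp \<Rightarrow> prog" where
  "search y b g = Loop ''x'' (Cond (Less (Var ''x'') b) (Loop ''a'' (Cond g (Assign y (Var ''x'') (Var ''a'')) Nop)) Nop)"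

definition prepare :: prog where
  "prepare = tables ;;
     search ''winner_pos'' rounds_exp
       (And (Less (Var ''a'') cands_exp) (Eq (axis_exp (Var ''x'') (Var ''a'')) (winner_exp (Var ''x'')))) ;;
     search ''peak_pos'' slots_exp
       (And (Less (Var ''a'') cands_exp)
         (Eq (axis_exp (Read ''div_n'' (Var ''x'')) (Var ''a'')) (peak_exp (Var ''x''))))"

lemma run_search:
  assumes y: "y \<noteq> ''x''" "y \<noteq> ''a''" "y \<noteq> ''length''"
    and b: "\<And>t. \<forall>z. z \<notin> {''x'', ''a'', y} \<longrightarrow> t z = s z \<Longrightarrow> aval b t = N"
    and N: "N \<le> s ''length'' 0"
    and g: "\<And>t. \<forall>z. z \<notin> {''x'', ''a'', y} \<longrightarrow> t z = s z \<Longrightarrow> t ''x'' 0 < N \<Longrightarrow>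
      t ''a'' 0 < s ''length'' 0 \<Longrightarrow> holds g t \<longleftrightarrow> t ''a'' 0 = f (t ''x'' 0)"
    and f: "\<And>k. k < N \<Longrightarrow> f k < s ''length'' 0"
  shows "\<forall>k<N. run (search y b g) s y k = f k"
proof -
  let ?inner = "Loop ''a'' (Cond g (Assign y (Var ''x'') (Var ''a'')) Nop)"
  have proper: "proper (search y b g)" using y by (auto simp: search_def)
  have "\<forall>k<s ''length'' 0. k < N \<longrightarrow> run (search y b g) s y k = f k"
    unfolding search_def
  proof (rule Loop_rule[where I = "\<lambda>n t. \<forall>k<n. k < N \<longrightarrow> t y k = f k"])
    fix n t
    assume n: "n < s ''length'' 0" "\<forall>k<n. k < N \<longrightarrow> t y k = f k" "t ''x'' 0 = n"
      "\<forall>z. z \<notin> writes (Loop ''x'' (Cond (Less (Var ''x'') b) ?inner Nop)) \<longrightarrow> t z = s z"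
    then have frame: "\<forall>z. z \<notin> {''x'', ''a'', y} \<longrightarrow> t z = s z" by auto
    have len: "t ''length'' 0 = s ''length'' 0" using frame y by auto
    have "(\<forall>k<n. k < N \<longrightarrow> run ?inner t y k = f k) \<and> (f n < t ''length'' 0 \<longrightarrow> run ?inner t y n = f n)"
      if "n < N"
    proof (rule Loop_rule[where I = "\<lambda>l r. (\<forall>k<n. k < N \<longrightarrow> r y k = f k) \<and> (f n < l \<longrightarrow> r y n = f n)"])
      fix l r
      assume l: "l < t ''length'' 0" "(\<forall>k<n. k < N \<longrightarrow> r y k = f k) \<and> (f n < l \<longrightarrow> r y n = f n)"
        "r ''a'' 0 = l" "\<forall>z. z \<notin> writes ?inner \<longrightarrow> r z = t z"
      then have "\<forall>z. z \<notin> {''x'', ''a'', y} \<longrightarrow> r z = s z" "r ''x'' 0 = n"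
        using frame n y by auto
      then have "holds g r \<longleftrightarrow> l = f n" using g[of r] l len that by auto
      then show "(\<forall>k<n. k < N \<longrightarrow> run (Cond g (Assign y (Var ''x'') (Var ''a'')) Nop) r y k = f k) \<and>
          (f n < Suc l \<longrightarrow> run (Cond g (Assign y (Var ''x'') (Var ''a'')) Nop) r y n = f n)"
        using l(2,3) \<open>r ''x'' 0 = n\<close> by (auto simp: less_Suc_eq)
    qed (use n y in auto)
    then show "\<forall>k<Suc n. k < N \<longrightarrow> run (Cond (Less (Var ''x'') b) ?inner Nop) t y k = f k"
      using b[OF frame] n f len by (auto simp: less_Suc_eq simp del: run.simps(5))
  qed (use proper y in \<open>auto simp: search_def\<close>)
  then show ?thesis using N by auto
qed

lemma writes_search: "writes (search y b g) = {''x'', ''a'', y}"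
  by (auto simp: search_def)

lemma nth_drop_header [simp]: "(x # y # z # xs) ! (3 + k) = xs ! k"
  by (simp add: numeral_3_eq_3)

context single_peaked_instance
begin

text \<open>The length of the encoding. It bounds every loop and later also serves as the price cap
  \<open>K\<close> of the auction.\<close>

definition L :: nat where
  "L = 3 + T * n * m + T * m + T"

definition loaded :: "state \<Rightarrow> bool" where
  "loaded s \<longleftrightarrow> s ''length'' 0 = L \<and> (\<forall>k<L. s ''input'' k = encode_election E ! k)"

lemma round_blocks:
  "j < T \<Longrightarrow> length (concat (map (P j) [0..<n])) = n * m"
  using length_concat_uniform[of n "P j" m] ranking by auto

lemma encode_election_append:
  "encode_election E = [n, m, T] @ concat (map (\<lambda>j. concat (map (P j) [0..<n])) [0..<T])
     @ concat (map (axes E) [0..<T]) @ map W [0..<T]"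
  by (simp add: encode_election_def n_def m_def T_def P_def W_def)

lemma block_lengths:
  "length (concat (map (\<lambda>j. concat (map (P j) [0..<n])) [0..<T])) = T * n * m"
  "length (concat (map (axes E) [0..<T])) = T * m"
  using length_concat_uniform[of T "\<lambda>j. concat (map (P j) [0..<n])" "n * m"] round_blocks
    length_concat_uniform[of T "axes E" m] axis by (auto simp: mult.assoc)

lemma length_encode_election: "length (encode_election E) = L"
  using block_lengths by (simp add: encode_election_append L_def)

lemma loaded_initial_state: "loaded (initial_state (encode_election E))"
  by (simp add: loaded_def initial_state_def length_encode_election)

lemma slot_less: "j < T \<Longrightarrow> i < k \<Longrightarrow> j * k + i < T * (k :: nat)"
  using mult_le_mono1[of "Suc j" T k] by simp

lemma slots_less_L: "T * n < L"
proof -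
  have "T * n * 1 \<le> T * n * m" using pos by (intro mult_le_mono2) auto
  then show ?thesis unfolding L_def by linarith
qed

lemma m_less_L: "m < L"
proof -
  have "1 * m \<le> T * m" using pos by (intro mult_le_mono1) auto
  then show ?thesis unfolding L_def by linarith
qed

lemma n_less_L: "n < L"
proof -
  have "1 * n \<le> T * n" using pos by (intro mult_le_mono1) auto
  then show ?thesis using slots_less_L by linarith
qed

lemma T_less_L: "T < L"
  by (simp add: L_def)

lemma loaded_header:
  assumes "loaded s"
  shows "s ''input'' 0 = n" "s ''input'' (Suc 0) = m" "s ''input'' 2 = T" "s ''length'' 0 = L"
  using assms by (auto simp: loaded_def L_def encode_election_append)

lemma loaded_peak:
  assumes "loaded s" "k < T * n"
  shows "s ''input'' (3 + k * m) = hd (P (k div n) (k mod n))"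
proof -
  have jk: "k div n < T" "k mod n < n"
    using assms(2) pos by (auto simp: less_mult_imp_div_less)
  \<comment> \<open>Slot \<open>k\<close> is voter \<open>k mod n\<close> of round
    \<open>k div n\<close>; the offset \<open>0\<close> selects the first entry of the
    ranking.\<close>
  have split: "k * m = (k div n) * (n * m) + ((k mod n) * m + 0)"
    by (metis add.right_neutral add_mult_distrib div_mult_mod_eq mult.assoc)
  have bound: "(k mod n) * m + 0 < n * m"
    using mult_le_mono1[of "Suc (k mod n)" n m] jk pos by simp
  have km: "k * m < T * n * m" using assms(2) pos by simp
  then have "3 + k * m < L" unfolding L_def by linarith
  then have "s ''input'' (3 + k * m) = encode_election E ! (3 + k * m)"
    using assms(1) by (simp add: loaded_def)
  also have "\<dots> = concat (map (\<lambda>j. concat (map (P j) [0..<n])) [0..<T]) ! (k * m)"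
    using km block_lengths(1) by (simp add: encode_election_append nth_append)
  also have "\<dots> = concat (map (P (k div n)) [0..<n]) ! ((k mod n) * m + 0)"
    using nth_concat_uniform[of T "\<lambda>j. concat (map (P j) [0..<n])" "n * m" "k div n" "(k mod n) * m + 0"]
      round_blocks jk bound unfolding split by auto
  also have "\<dots> = P (k div n) (k mod n) ! 0"
    using ranking jk pos by (intro nth_concat_uniform) auto
  also have "\<dots> = hd (P (k div n) (k mod n))"
    using ranking(3)[OF jk] pos by (intro hd_conv_nth[symmetric]) auto
  finally show ?thesis .
qed

lemma loaded_axis:
  assumes "loaded s" "j < T" "a < m"
  shows "s ''input'' (3 + (T * n * m + (j * m + a))) = axes E j ! a"
proof -
  have "concat (map (axes E) [0..<T]) ! (j * m + a) = axes E j ! a"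
    using axis assms by (intro nth_concat_uniform) auto
  then show ?thesis
    using assms(1) block_lengths slot_less[OF assms(2,3)]
    by (simp add: loaded_def encode_election_append L_def nth_append)
qed

lemma loaded_winner:
  assumes "loaded s" "j < T"
  shows "s ''input'' (3 + (T * n * m + (T * m + j))) = W j"
  using assms block_lengths
  by (simp add: loaded_def encode_election_append L_def nth_append)

definition tabulated :: "state \<Rightarrow> bool" where
  "tabulated s \<longleftrightarrow> loaded s \<and>
     (\<forall>k\<le>L. s ''times_n'' k = k * n \<and> s ''times_m'' k = k * m \<and> s ''div_n'' k = k div n)"

lemma run_tables:
  assumes "loaded s" "s ''times_n'' 0 = 0" "s ''times_m'' 0 = 0" "s ''div_n'' 0 = 0"
  shows "tabulated (run tables s)"
proof -
  have "\<forall>i\<le>s ''length'' 0. run tables s ''times_n'' i = i * n \<and> run tables s ''times_m'' i = i * m \<and>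
      run tables s ''div_n'' i = i div n"
    unfolding tables_def
  proof (rule Loop_rule[where I = "\<lambda>k t. \<forall>i\<le>k. t ''times_n'' i = i * n \<and> t ''times_m'' i = i * m \<and>
      t ''div_n'' i = i div n"], goal_cases)
    case (4 k t)
    have t: "t ''times_n'' i = i * n" "t ''times_m'' i = i * m" "t ''div_n'' i = i div n" if "i \<le> k" for i
      using 4(2) that by auto
    have inp: "t ''input'' 0 = n" "t ''input'' (Suc 0) = m"
      using 4(4) loaded_header[OF assms(1)] by auto
    have "k div n \<le> k" by simp
    \<comment> \<open>The entry consulted is the one just written when \<open>k div n = k\<close>,
      so the order of the assignments matters.\<close>
    then have tn: "((t ''times_n'')(Suc k := k * n + n)) (Suc (k div n)) = Suc (k div n) * n"
      using t(1)[of "Suc (k div n)"] \<open>k div n \<le> k\<close> by (cases "k div n = k") (auto simp: add.commute)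
    have div_Suc_k: "Suc k div n = (if Suc k = Suc (k div n) * n then Suc (k div n) else k div n)"
    proof -
      have "Suc k mod n = 0 \<longleftrightarrow> Suc k = Suc (k div n) * n"
      proof
        assume z: "Suc k mod n = 0"
        then have "Suc k div n = Suc (k div n)" by (simp add: div_Suc)
        then show "Suc k = Suc (k div n) * n" using z div_mult_mod_eq[of "Suc k" n] by simp
      next
        assume "Suc k = Suc (k div n) * n"
        then show "Suc k mod n = 0" by (metis mod_mult_self2_is_0)
      qed
      then show ?thesis by (simp add: div_Suc)
    qed
    show ?case
      using t inp 4(3) tn div_Suc_k by (auto simp: le_Suc_eq)
  qed (use assms in auto)
  moreover have "loaded (run tables s)"
    using assms(1) by (simp add: loaded_def run_frame tables_def del: run.simps)
  ultimately show ?thesis using assms(1) by (simp add: tabulated_def loaded_def)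
qed

lemma tabulated_frame:
  assumes "tabulated s" "\<And>z. z \<in> {''input'', ''length'', ''times_n'', ''times_m'', ''div_n''} \<Longrightarrow> t z = s z"
  shows "tabulated t"
  using assms by (simp add: tabulated_def loaded_def)

lemma tabulated_slots_exp: "tabulated s \<Longrightarrow> aval slots_exp s = T * n"
  using loaded_header[of s] T_less_L by (auto simp: slots_exp_def tabulated_def)

lemma tabulated_axis_exp:
  assumes "tabulated s" "aval r s < T" "aval a s < m"
  shows "aval (axis_exp r a) s = axes E (aval r s) ! aval a s"
  using loaded_axis[of s "aval r s" "aval a s"] assms T_less_L slots_less_L tabulated_slots_exp[OF assms(1)]
  by (simp add: axis_exp_def tabulated_def)

lemma tabulated_winner_exp:
  assumes "tabulated s" "aval r s < T"
  shows "aval (winner_exp r) s = W (aval r s)"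
  using loaded_winner[of s "aval r s"] assms T_less_L slots_less_L tabulated_slots_exp[OF assms(1)]
    loaded_header[of s]
  by (simp add: winner_exp_def tabulated_def)

lemma tabulated_peak_exp:
  assumes "tabulated s" "aval k s < T * n"
  shows "aval (peak_exp k) s = hd (P (aval k s div n) (aval k s mod n))"
  using loaded_peak[of s "aval k s"] assms slots_less_L
  by (simp add: peak_exp_def tabulated_def)

definition ready :: "state \<Rightarrow> bool" where
  "ready s \<longleftrightarrow> tabulated s \<and> (\<forall>j<T. s ''winner_pos'' j = winner_pos j) \<and>
     (\<forall>k<T * n. s ''peak_pos'' k = peak_pos (k div n) (k mod n))"

lemma run_winner_search:
  assumes "tabulated s"
  shows "\<forall>j<T. run (search ''winner_pos'' rounds_exp
      (And (Less (Var ''a'') cands_exp) (Eq (axis_exp (Var ''x'') (Var ''a'')) (winner_exp (Var ''x''))))) s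
      ''winner_pos'' j = winner_pos j"
proof (rule run_search)
  note head = loaded_header[of s]
  show "T \<le> s ''length'' 0" using T_less_L assms head by (simp add: tabulated_def)
  show "aval rounds_exp t = T" if "\<forall>z. z \<notin> {''x'', ''a'', ''winner_pos''} \<longrightarrow> t z = s z" for t
    using that assms head by (simp add: tabulated_def)
  show "winner_pos k < s ''length'' 0" if "k < T" for k
    using winner_pos(1)[OF that] m_less_L assms head by (simp add: tabulated_def)
  fix t assume t: "\<forall>z. z \<notin> {''x'', ''a'', ''winner_pos''} \<longrightarrow> t z = s z" "t ''x'' 0 < T"
  have tab: "tabulated t" by (intro tabulated_frame[OF assms] t(1)[rule_format]) auto
  then have "t ''input'' (Suc 0) = m" using loaded_header by (simp add: tabulated_def)
  moreover have "aval (winner_exp (Var ''x'')) t = W (t ''x'' 0)"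
    using tabulated_winner_exp[OF tab, of "Var ''x''"] t(2) by simp
  moreover have "aval (axis_exp (Var ''x'') (Var ''a'')) t = axes E (t ''x'' 0) ! t ''a'' 0"
    if "t ''a'' 0 < m"
    using tabulated_axis_exp[OF tab, of "Var ''x''" "Var ''a''"] t(2) that by simp
  moreover have "axes E (t ''x'' 0) ! t ''a'' 0 = W (t ''x'' 0) \<longleftrightarrow> t ''a'' 0 = winner_pos (t ''x'' 0)"
    if "t ''a'' 0 < m"
    unfolding winner_pos_def
    by (rule position_eq_iff) (use axis[OF t(2)] winner[OF t(2)] that in simp_all)
  \<comment> \<open>Beyond the axis the guard \<open>a < m\<close> fails, and so does the right-hand
    side because \<open>winner_pos\<close> is below \<open>m\<close>.\<close>
  ultimately show "holds (And (Less (Var ''a'') cands_exp) (Eq (axis_exp (Var ''x'') (Var ''a'')) (winner_exp (Var ''x'')))) t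
      \<longleftrightarrow> t ''a'' 0 = winner_pos (t ''x'' 0)"
    using winner_pos(1)[OF t(2)] by (cases "t ''a'' 0 < m") auto
qed auto

lemma run_peak_search:
  assumes "tabulated s"
  shows "\<forall>k<T * n. run (search ''peak_pos'' slots_exp
      (And (Less (Var ''a'') cands_exp)
         (Eq (axis_exp (Read ''div_n'' (Var ''x'')) (Var ''a'')) (peak_exp (Var ''x''))))) s
      ''peak_pos'' k = peak_pos (k div n) (k mod n)"
proof (rule run_search)
  note head = loaded_header[of s]
  have jk: "k div n < T" "k mod n < n" if "k < T * n" for k
    using that pos by (auto simp: less_mult_imp_div_less)
  show "T * n \<le> s ''length'' 0" using slots_less_L assms head by (simp add: tabulated_def)
  show "aval slots_exp t = T * n" if "\<forall>z. z \<notin> {''x'', ''a'', ''peak_pos''} \<longrightarrow> t z = s z" for t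
    by (intro tabulated_slots_exp tabulated_frame[OF assms] that[rule_format]) auto
  show "peak_pos (k div n) (k mod n) < s ''length'' 0" if "k < T * n" for k
    using peak_pos(1)[OF jk[OF that]] m_less_L assms head by (simp add: tabulated_def)
  fix t assume t: "\<forall>z. z \<notin> {''x'', ''a'', ''peak_pos''} \<longrightarrow> t z = s z" "t ''x'' 0 < T * n"
  have tab: "tabulated t" by (intro tabulated_frame[OF assms] t(1)[rule_format]) auto
  then have "t ''input'' (Suc 0) = m" using loaded_header by (simp add: tabulated_def)
  moreover have "t ''div_n'' (t ''x'' 0) = t ''x'' 0 div n"
    using tab t(2) slots_less_L by (simp add: tabulated_def)
  moreover have "aval (peak_exp (Var ''x'')) t = hd (P (t ''x'' 0 div n) (t ''x'' 0 mod n))"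
    using tabulated_peak_exp[OF tab, of "Var ''x''"] t(2) by simp
  moreover have "aval (axis_exp (Read ''div_n'' (Var ''x'')) (Var ''a'')) t = axes E (t ''x'' 0 div n) ! t ''a'' 0"
    if "t ''a'' 0 < m"
    using tabulated_axis_exp[OF tab, of "Read ''div_n'' (Var ''x'')" "Var ''a''"] jk[OF t(2)] that
      calculation(2) by simp
  moreover have "axes E (t ''x'' 0 div n) ! t ''a'' 0 = hd (P (t ''x'' 0 div n) (t ''x'' 0 mod n))
      \<longleftrightarrow> t ''a'' 0 = peak_pos (t ''x'' 0 div n) (t ''x'' 0 mod n)" if "t ''a'' 0 < m"
    unfolding peak_pos_def
  proof (rule position_eq_iff)
    show "hd (P (t ''x'' 0 div n) (t ''x'' 0 mod n)) \<in> set (axes E (t ''x'' 0 div n))"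
      using peak_pos[OF jk[OF t(2)]] axis(3)[OF jk(1)[OF t(2)]] by (metis nth_mem)
  qed (use axis[OF jk(1)[OF t(2)]] that in simp_all)
  ultimately show "holds (And (Less (Var ''a'') cands_exp)
        (Eq (axis_exp (Read ''div_n'' (Var ''x'')) (Var ''a'')) (peak_exp (Var ''x'')))) t
      \<longleftrightarrow> t ''a'' 0 = peak_pos (t ''x'' 0 div n) (t ''x'' 0 mod n)"
    using peak_pos(1)[OF jk[OF t(2)]] by (cases "t ''a'' 0 < m") auto
qed auto

lemma ready_prepare: "ready (run prepare (initial_state (encode_election E)))"
proof -
  define s where "s = run tables (initial_state (encode_election E))"
  have tab: "tabulated s"
    unfolding s_def using loaded_initial_state by (intro run_tables) (auto simp: initial_state_def)
  define r where "r = run (search ''winner_pos'' rounds_exp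
      (And (Less (Var ''a'') cands_exp) (Eq (axis_exp (Var ''x'') (Var ''a'')) (winner_exp (Var ''x''))))) s"
  have r: "\<forall>j<T. r ''winner_pos'' j = winner_pos j" "tabulated r"
    using run_winner_search[OF tab]
    by (simp add: r_def) (rule tabulated_frame[OF tab], auto simp: r_def run_frame writes_search)
  define q where "q = run (search ''peak_pos'' slots_exp
      (And (Less (Var ''a'') cands_exp)
         (Eq (axis_exp (Read ''div_n'' (Var ''x'')) (Var ''a'')) (peak_exp (Var ''x''))))) r"
  have "\<forall>k<T * n. q ''peak_pos'' k = peak_pos (k div n) (k mod n)"
    using run_peak_search[OF r(2)] by (simp add: q_def)
  moreover have "q ''winner_pos'' = r ''winner_pos''"
    by (simp add: q_def run_frame writes_search)
  moreover have "tabulated q"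
    by (rule tabulated_frame[OF r(2)]) (auto simp: q_def run_frame writes_search)
  ultimately show ?thesis using r(1) by (simp add: ready_def prepare_def q_def r_def s_def)
qed

end

section \<open>Program text of the two verifiers\<close>

definition compatible_exp :: "aexp \<Rightarrow> aexp" where
  "compatible_exp r =
     (let w = Read ''winner_pos'' r;
          p = Read ''peak_pos'' (Plus (Read ''times_n'' r) (Var ''h''));
          q = Read ''peak_pos'' (Plus (Read ''times_n'' r) (Var ''i''))
      in Or (And (Less p w) (Less q w)) (And (Less w p) (Less w q)))"

text \<open>\<open>best\<close> starts at the price cap and stays there exactly when voter
  \<open>i\<close> has no adjacent slot below the cap, that is, nothing to bid for.\<close>

definition cheapest_slot :: prog where
  "cheapest_slot =
     Assign ''best'' (Const 0) (Var ''length'') ;;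
     Loop ''s'' (Cond (And (Less (Var ''s'') slots_exp)
         (And (Neg (compatible_exp (Read ''div_n'' (Var ''s''))))
           (Less (Read ''price'' (Var ''s'')) (Var ''best''))))
       (Assign ''slot'' (Const 0) (Var ''s'') ;; Assign ''best'' (Const 0) (Read ''price'' (Var ''s'')))
       Nop)"

definition evict_owner :: prog where
  "evict_owner =
     Cond (Less (Const 0) (Read ''owner'' (Var ''slot'')))
       (Assign ''tokens'' (Minus (Read ''owner'' (Var ''slot'')) (Const 1))
         (Plus (Read ''tokens'' (Minus (Read ''owner'' (Var ''slot'')) (Const 1))) (Const 1)))
       Nop"

definition place_bid :: prog where
  "place_bid = evict_owner ;;
     Assign ''owner'' (Var ''slot'') (Plus (Var ''i'') (Const 1)) ;;
     Assign ''tokens'' (Var ''i'') (Minus (Read ''tokens'' (Var ''i'')) (Const 1)) ;;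
     Assign ''price'' (Var ''slot'') (Plus (Read ''price'' (Var ''slot'')) (Const 1))"

definition attempt :: prog where
  "attempt = Cond (And (Less (Var ''i'') voters_exp) (Less (Const 0) (Read ''tokens'' (Var ''i''))))
     (cheapest_slot ;; Cond (Less (Var ''best'') (Var ''length'')) place_bid Nop) Nop"

text \<open>Both \<open>n\<close> and \<open>T * n\<close> are below the loop bound, so a single
  loop reaches all voters and all slots.\<close>

definition reset :: prog where
  "reset = Loop ''i'' (Assign ''tokens'' (Var ''i'') rounds_exp ;;
     Assign ''owner'' (Var ''i'') (Const 0) ;; Assign ''price'' (Var ''i'') (Const 0))"

definition sweep :: prog where
  "sweep = Loop ''i'' attempt"

definition count_tokens :: prog where
  "count_tokens = Assign ''count'' (Const 0) (Const 0) ;;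
     Loop ''i'' (Cond (Less (Var ''i'') voters_exp)
       (Assign ''count'' (Const 0) (Plus (Var ''count'') (Read ''tokens'' (Var ''i'')))) Nop)"

text \<open>Adding \<open>T\<close> for each voter without conflict produces the product in
  \<open>all_rank_wJR_iff\<close> without a multiplication.\<close>

definition count_followers :: prog where
  "count_followers = Assign ''count'' (Const 0) (Const 0) ;;
     Loop ''i'' (Cond (Less (Var ''i'') voters_exp)
       (Assign ''conflict'' (Const 0) (Const 0) ;;
        Loop ''j'' (Cond (And (Less (Var ''j'') rounds_exp) (Neg (compatible_exp (Var ''j''))))
          (Assign ''conflict'' (Const 0) (Const 1)) Nop) ;;
        Cond (Var ''conflict'') Nop (Assign ''count'' (Const 0) (Plus (Var ''count'') rounds_exp)))
       Nop)"

text \<open>Both axioms amount to a quantity depending on \<open>h\<close> being below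
  \<open>n\<close> for all \<open>h\<close>; the program \<open>p\<close> has to leave it in
  \<open>count\<close>.\<close>

definition for_each_voter :: "prog \<Rightarrow> prog" where
  "for_each_voter p = prepare ;; Assign ''output'' (Const 0) (Const 1) ;;
     Loop ''h'' (Cond (Less (Var ''h'') voters_exp)
       (p ;; Cond (Less (Var ''count'') voters_exp) Nop (Assign ''output'' (Const 0) (Const 0))) Nop)"

definition wJR_verifier :: prog where
  "wJR_verifier = for_each_voter count_followers"

text \<open>The nested loops perform \<open>L * L\<close> sweeps, more than the potential can rise,
  so the auction is over when the tokens are counted.\<close>

definition wPJR_verifier :: prog where
  "wPJR_verifier = for_each_voter (reset ;; Loop ''y'' (Loop ''z'' sweep) ;; count_tokens)"

lemmas program_defs = tables_def search_def prepare_def cheapest_slot_def place_bid_def evict_owner_def attempt_def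
  reset_def sweep_def count_tokens_def count_followers_def for_each_voter_def

lemma proper_verifiers: "proper wJR_verifier" "proper wPJR_verifier"
  by (simp_all add: wJR_verifier_def wPJR_verifier_def program_defs)

lemma writes_attempt: "writes attempt = {''best'', ''s'', ''slot'', ''tokens'', ''owner'', ''price''}"
  by (auto simp: attempt_def cheapest_slot_def place_bid_def evict_owner_def)

lemma proper_attempt: "proper attempt"
  by (simp add: attempt_def cheapest_slot_def place_bid_def evict_owner_def)

lemma run_evict_owner:
  "run evict_owner s ''tokens'' = evict (s ''tokens'') (s ''owner'' (s ''slot'' 0))"
  "z \<noteq> ''tokens'' \<Longrightarrow> run evict_owner s z = s z"
  by (cases "s ''owner'' (s ''slot'' 0)"; simp add: evict_owner_def evict_def del: fun_upd_apply)+

lemma run_place_bid: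
  assumes "c = s ''slot'' 0" "i = s ''i'' 0"
  shows "run place_bid s ''tokens'' = (evict (s ''tokens'') (s ''owner'' c))
      (i := evict (s ''tokens'') (s ''owner'' c) i - 1)"
    and "run place_bid s ''owner'' = (s ''owner'')(c := Suc i)"
    and "run place_bid s ''price'' = (s ''price'')(c := Suc (s ''price'' c))"
  using assms by (simp_all add: place_bid_def run_evict_owner del: fun_upd_apply)

abbreviation static :: "string set" where
  "static \<equiv> {''input'', ''length'', ''times_n'', ''times_m'', ''div_n'', ''winner_pos'', ''peak_pos''}"

section \<open>Correctness and termination of the programmed auction\<close>

context single_peaked_instance
begin

lemma ready_frame:
  assumes "ready s" "\<And>z. z \<in> static \<Longrightarrow> t z = s z"
  shows "ready t"
  using assms by (simp add: ready_def tabulated_def loaded_def)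

lemma ready_header:
  assumes "ready s"
  shows "s ''input'' 0 = n" "s ''input'' 2 = T" "s ''length'' 0 = L" "aval slots_exp s = T * n"
    "k < L \<Longrightarrow> s ''div_n'' k = k div n"
  using assms loaded_header[of s] tabulated_slots_exp[of s] by (auto simp: ready_def tabulated_def)

lemma ready_run:
  assumes "ready s" "writes p \<inter> static = {}"
  shows "ready (run p s)"
proof (rule ready_frame[OF assms(1)])
  fix z assume "z \<in> static"
  then have "z \<notin> writes p" using IntI[of z "writes p" static] assms(2) by force
  then show "run p s z = s z" by (rule run_frame)
qed

lemma ready_upd: "ready s \<Longrightarrow> x \<notin> static \<Longrightarrow> ready (upd s x k v)"
  by (erule ready_frame, rule upd_other) metis

lemma holds_compatible_exp:
  assumes "ready s" "s ''h'' 0 < n" "s ''i'' 0 < n" "aval r s < T"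
  shows "holds (compatible_exp r) s \<longleftrightarrow> compatible (s ''h'' 0) (s ''i'' 0) (aval r s)"
proof -
  define j where "j = aval r s"
  have peak: "s ''peak_pos'' (j * n + i) = peak_pos j i" if "i < n" for i
    using assms(1,4) that slot_less[of j i n] by (simp add: ready_def j_def)
  have "s ''times_n'' j = j * n" "s ''winner_pos'' j = winner_pos j"
    using assms(1,4) T_less_L by (simp_all add: ready_def tabulated_def j_def)
  then show ?thesis
    using assms(2,3) by (simp add: compatible_exp_def compatible_def peak Let_def j_def[symmetric])
qed

abbreviation slot_adj :: "nat \<Rightarrow> nat \<Rightarrow> nat \<Rightarrow> bool" where
  "slot_adj h i s \<equiv> \<not> compatible h i (s div n)"

lemma run_cheapest_slot:
  assumes "ready s" "s ''h'' 0 < n" "s ''i'' 0 < n"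
  defines "h \<equiv> s ''h'' 0" and "i \<equiv> s ''i'' 0" and "p \<equiv> s ''price''"
    and "t \<equiv> run cheapest_slot s"
  defines "b \<equiv> t ''best'' 0" and "c \<equiv> t ''slot'' 0"
  shows "\<forall>r<T * n. slot_adj h i r \<longrightarrow> b \<le> p r"
    and "b < L \<Longrightarrow> c < T * n \<and> slot_adj h i c \<and> p c = b"
    and "b \<le> L"
proof -
  define s0 where "s0 = upd s ''best'' 0 L"
  let ?body = "Cond (And (Less (Var ''s'') slots_exp)
         (And (Neg (compatible_exp (Read ''div_n'' (Var ''s''))))
           (Less (Read ''price'' (Var ''s'')) (Var ''best''))))
       (Assign ''slot'' (Const 0) (Var ''s'') ;; Assign ''best'' (Const 0) (Read ''price'' (Var ''s'')))
       Nop"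
  \<comment> \<open>\<open>best\<close> is the least price among the adjacent slots seen so far,
    capped at \<open>L\<close>; \<open>slot\<close> is meaningful only once \<open>best\<close> has
    dropped below \<open>L\<close>.\<close>
  define I where "I k r \<longleftrightarrow> r ''best'' 0 \<le> L \<and>
      (\<forall>q<k. q < T * n \<longrightarrow> slot_adj h i q \<longrightarrow> r ''best'' 0 \<le> p q) \<and>
      (r ''best'' 0 < L \<longrightarrow> r ''slot'' 0 < T * n \<and> slot_adj h i (r ''slot'' 0) \<and>
         p (r ''slot'' 0) = r ''best'' 0)" for k and r :: state
  have "I (s0 ''length'' 0) (run (Loop ''s'' ?body) s0)"
  proof (rule Loop_rule, goal_cases)
    case (4 k r)
    have "r z = s z" if "z \<in> static \<union> {''h'', ''i'', ''price''}" for z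
      using 4(4)[rule_format, of z] that by (auto simp: s0_def)
    then have fr: "r ''h'' 0 = h" "r ''i'' 0 = i" "r ''price'' = p" "ready r"
      using ready_frame[OF assms(1), of r] by (simp_all add: h_def i_def p_def)
    note hd = ready_header[OF fr(4)]
    have div: "r ''div_n'' k = k div n" if "k < T * n" using hd(5) slots_less_L that by simp
    have "holds (compatible_exp (Read ''div_n'' (Var ''s''))) r \<longleftrightarrow> compatible h i (k div n)"
      if "k < T * n"
      using holds_compatible_exp[OF fr(4), of "Read ''div_n'' (Var ''s'')"] div[OF that] that 4(3) fr
        assms(2,3) by (simp add: h_def i_def less_mult_imp_div_less)
    then show ?case
      using 4(2,3) fr(3) hd(4) by (cases "k < T * n") (auto simp: I_def less_Suc_eq)
  qed (auto simp: I_def s0_def)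
  moreover have "t = run (Loop ''s'' ?body) s0"
    using ready_header(3)[OF assms(1)] by (simp add: t_def cheapest_slot_def s0_def)
  moreover have "s0 ''length'' 0 = L"
    using ready_header(3)[OF assms(1)] by (simp add: s0_def)
  ultimately have "I L t" by simp
  then show "\<forall>r<T * n. slot_adj h i r \<longrightarrow> b \<le> p r" "b \<le> L"
    "b < L \<Longrightarrow> c < T * n \<and> slot_adj h i c \<and> p c = b"
    using slots_less_L by (auto simp: I_def b_def c_def)
qed

lemma auction_L: "auction n T L"
  using pos slots_less_L by unfold_locales auto

abbreviation "valid h \<equiv> auction.valid n T L (\<lambda>i j. \<not> compatible h i j)"
abbreviation "eligible h \<equiv> auction.eligible n T L (\<lambda>i j. \<not> compatible h i j)"
abbreviation "potential \<equiv> auction.potential n T"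

definition bidding :: "nat \<Rightarrow> state \<Rightarrow> bool" where
  "bidding h s \<longleftrightarrow> ready s \<and> s ''h'' 0 = h \<and> valid h (s ''tokens'') (s ''owner'') (s ''price'')"

lemma bidding_upd:
  "bidding h s \<Longrightarrow> x \<notin> static \<union> {''h'', ''tokens'', ''owner'', ''price''} \<Longrightarrow> bidding h (upd s x k v)"
  by (simp add: bidding_def ready_upd upd_other[OF not_sym])

text \<open>The dichotomy behind termination: an attempt either makes a bid and raises the
  potential, or leaves the auction untouched and shows that the voter, if \<open>i < n\<close>,
  cannot bid.\<close>

lemma run_attempt:
  assumes s: "bidding h s" and h: "h < n"
  defines "t \<equiv> run attempt s"
  shows "bidding h t"
    and "s ''i'' 0 < n \<and> eligible h (s ''tokens'') (s ''price'') (s ''i'' 0) \<and>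
        potential (t ''price'') = Suc (potential (s ''price'')) \<or>
      (\<forall>z \<in> {''tokens'', ''owner'', ''price''}. t z = s z) \<and>
      (s ''i'' 0 < n \<longrightarrow> \<not> eligible h (s ''tokens'') (s ''price'') (s ''i'' 0))"
proof -
  have rs: "ready s" "s ''h'' 0 = h" using s by (simp_all add: bidding_def)
  have rt: "ready t" "t ''h'' 0 = h"
    using rs ready_run[of s attempt] by (simp_all add: t_def writes_attempt run_frame)
  define i where "i = s ''i'' 0"
  define r where "r = run cheapest_slot s"
  define c where "c = r ''slot'' 0"
  have r: "r z = s z" if "z \<notin> {''best'', ''s'', ''slot''}" for z
    using that by (simp add: r_def run_frame cheapest_slot_def del: run.simps)
  show "bidding h t" "s ''i'' 0 < n \<and> eligible h (s ''tokens'') (s ''price'') (s ''i'' 0) \<and>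
        potential (t ''price'') = Suc (potential (s ''price'')) \<or>
      (\<forall>z \<in> {''tokens'', ''owner'', ''price''}. t z = s z) \<and>
      (s ''i'' 0 < n \<longrightarrow> \<not> eligible h (s ''tokens'') (s ''price'') (s ''i'' 0))"
  proof (atomize (full), cases "i < n \<and> 0 < s ''tokens'' i")
    case False
    then have "t = s" using ready_header[OF rs(1)] by (auto simp: t_def attempt_def i_def)
    then show "bidding h t \<and> (s ''i'' 0 < n \<and> eligible h (s ''tokens'') (s ''price'') (s ''i'' 0) \<and>
        potential (t ''price'') = Suc (potential (s ''price'')) \<or>
      (\<forall>z \<in> {''tokens'', ''owner'', ''price''}. t z = s z) \<and>
      (s ''i'' 0 < n \<longrightarrow> \<not> eligible h (s ''tokens'') (s ''price'') (s ''i'' 0)))"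
      using s False by (auto simp: auction.eligible_def[OF auction_L] i_def)
  next
    case True
    then have search: "\<forall>q<T * n. slot_adj h i q \<longrightarrow> r ''best'' 0 \<le> s ''price'' q"
      "r ''best'' 0 < L \<Longrightarrow> c < T * n \<and> slot_adj h i c \<and> s ''price'' c = r ''best'' 0"
      using run_cheapest_slot[of s] rs h by (auto simp: i_def r_def c_def)
    have t: "t = (if r ''best'' 0 < L then run place_bid r else r)"
      using ready_header[OF rs(1)] True r[of "''length''"]
      by (simp add: t_def attempt_def i_def r_def)
    show "bidding h t \<and> (s ''i'' 0 < n \<and> eligible h (s ''tokens'') (s ''price'') (s ''i'' 0) \<and>
        potential (t ''price'') = Suc (potential (s ''price'')) \<or>
      (\<forall>z \<in> {''tokens'', ''owner'', ''price''}. t z = s z) \<and>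
      (s ''i'' 0 < n \<longrightarrow> \<not> eligible h (s ''tokens'') (s ''price'') (s ''i'' 0)))"
    proof (cases "r ''best'' 0 < L")
      case False
      then have "\<forall>z \<in> {''tokens'', ''owner'', ''price''}. t z = s z" using t r by simp
      moreover have "\<not> eligible h (s ''tokens'') (s ''price'') i"
        using False search(1) by (force simp: auction.eligible_def[OF auction_L])
      ultimately show ?thesis using s rt by (simp add: bidding_def i_def)
    next
      case best: True
      have "t ''tokens'' = (evict (s ''tokens'') (s ''owner'' c))
          (i := evict (s ''tokens'') (s ''owner'' c) i - 1)"
        "t ''owner'' = (s ''owner'')(c := Suc i)"
        "t ''price'' = (s ''price'')(c := Suc (s ''price'' c))"
        using run_place_bid[of c r i] best t r by (simp_all add: c_def i_def del: fun_upd_apply)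
      moreover have "eligible h (s ''tokens'') (s ''price'') i"
        using True best search by (auto simp: auction.eligible_def[OF auction_L])
      ultimately show ?thesis
        using auction.valid_bid[OF auction_L, of "\<lambda>i j. \<not> compatible h i j" "s ''tokens''" "s ''owner''"
            "s ''price''" i c] True s search best rt
        by (simp add: bidding_def i_def)
    qed
  qed
qed

definition stuck :: "nat \<Rightarrow> state \<Rightarrow> bool" where
  "stuck h s \<longleftrightarrow> (\<forall>i<n. \<not> eligible h (s ''tokens'') (s ''price'') i)"

text \<open>A sweep without a bid has tested all voters against one unchanged auction state, which
  is therefore stuck.\<close>

lemma run_sweep:
  assumes s: "bidding h s" and h: "h < n"
  defines "t \<equiv> run sweep s"
  shows "bidding h t"
    and "stuck h t \<or> potential (s ''price'') < potential (t ''price'')"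
    and "stuck h s \<Longrightarrow> stuck h t"
proof -
  have rs: "ready s" using s by (simp add: bidding_def)
  \<comment> \<open>At the first bid the auction state is still that of \<open>s\<close>, so the
    bidder is eligible in \<open>s\<close>. The conjunct \<open>\<not> stuck h s\<close> records
    this, and it shows that stuck states persist.\<close>
  define I where "I k r \<longleftrightarrow> bidding h r \<and>
      ((\<forall>z \<in> {''tokens'', ''owner'', ''price''}. r z = s z) \<and>
        (\<forall>i<k. i < n \<longrightarrow> \<not> eligible h (s ''tokens'') (s ''price'') i)
      \<or> potential (s ''price'') < potential (r ''price'') \<and> \<not> stuck h s)" for k r
  have "I (s ''length'' 0) (run (Loop ''i'' attempt) s)"
  proof (rule Loop_rule, goal_cases)
    case (3 k r v)
    then show ?case by (simp add: I_def bidding_upd)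
  next
    case (4 k r)
    have r: "bidding h r" using 4(2) by (simp add: I_def)
    note att = run_attempt[OF r h]
    show ?case
    proof (cases "\<forall>z \<in> {''tokens'', ''owner'', ''price''}. r z = s z")
      case True
      then show ?thesis
        using att 4(2,3) by (auto simp: I_def less_Suc_eq stuck_def)
    next
      case False
      then show ?thesis
        using att 4(2) by (auto simp: I_def)
    qed
  qed (use s in \<open>auto simp: I_def proper_attempt writes_attempt\<close>)
  then have I: "I L t"
    using ready_header(3)[OF rs] by (simp only: t_def sweep_def)
  then show "bidding h t" by (simp add: I_def)
  show "stuck h t \<or> potential (s ''price'') < potential (t ''price'')" "stuck h s \<Longrightarrow> stuck h t"
    using I n_less_L by (auto simp: I_def stuck_def)
qed

lemma writes_sweep: "writes sweep = insert ''i'' (writes attempt)"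
  by (simp add: sweep_def)

lemma proper_sweep: "proper sweep"
  by (simp add: sweep_def proper_attempt writes_attempt)

lemma stuck_upd: "x \<notin> {''tokens'', ''price''} \<Longrightarrow> stuck h (upd s x k v) = stuck h s"
  by (simp add: stuck_def upd_other[OF not_sym])

lemma run_sweeps:
  assumes s: "bidding h s" and h: "h < n"
  shows "bidding h (run (Loop ''y'' (Loop ''z'' sweep)) s)" "stuck h (run (Loop ''y'' (Loop ''z'' sweep)) s)"
proof -
  have len: "r ''length'' 0 = L" if "bidding h r" for r
    using that ready_header(3) by (auto simp: bidding_def)
  define I where "I k r \<longleftrightarrow> bidding h r \<and> (stuck h r \<or> k * L \<le> potential (r ''price''))" for k r
  have "I (s ''length'' 0) (run (Loop ''y'' (Loop ''z'' sweep)) s)"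
  proof (rule Loop_rule, goal_cases)
    case (4 k r)
    \<comment> \<open>\<open>k * L + l\<close> is the number of sweeps done; unless the auction is
      stuck, each has raised the potential by at least one.\<close>
    define J where "J l q \<longleftrightarrow> bidding h q \<and> (stuck h q \<or> k * L + l \<le> potential (q ''price''))" for l q
    have "J (r ''length'' 0) (run (Loop ''z'' sweep) r)"
    proof (rule Loop_rule, goal_cases)
      case (4 l q)
      then have q: "bidding h q" by (simp add: J_def)
      show ?case using run_sweep[OF q h] 4(2) by (auto simp: J_def)
    qed (use 4 in \<open>auto simp: J_def I_def bidding_upd stuck_upd proper_sweep writes_sweep writes_attempt\<close>)
    then show ?case
      using 4(2) len[of r] by (simp add: I_def J_def add.commute del: run.simps)
  qed (use s in \<open>auto simp: I_def bidding_upd stuck_upd proper_sweep writes_sweep writes_attempt\<close>)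
  then have I: "I L (run (Loop ''y'' (Loop ''z'' sweep)) s)" using len[OF s] by simp
  then show b: "bidding h (run (Loop ''y'' (Loop ''z'' sweep)) s)" by (simp add: I_def)
  \<comment> \<open>Prices are at most \<open>L\<close> on \<open>T * n < L\<close> slots, so the
    potential cannot reach \<open>L * L\<close>, the bound that \<open>I\<close> gives for an
    auction that is not stuck.\<close>
  have "potential (run (Loop ''y'' (Loop ''z'' sweep)) s ''price'') \<le> T * n * L"
    using b auction.potential_le[OF auction_L] by (auto simp: bidding_def)
  also have "\<dots> < L * L" using slots_less_L by (intro mult_strict_right_mono) auto
  finally show "stuck h (run (Loop ''y'' (Loop ''z'' sweep)) s)"
    using I by (auto simp: I_def)
qed

section \<open>Initialisation, counting and the complete verifiers\<close>

lemma run_reset: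
  assumes "ready s" "s ''h'' 0 = h"
  shows "bidding h (run reset s)"
proof -
  have w: "writes reset = {''i'', ''tokens'', ''owner'', ''price''}"
    by (auto simp: reset_def)
  have "ready (run reset s)" "run reset s ''h'' 0 = h"
    using assms ready_run[of s reset] by (simp_all add: w run_frame)
  moreover have "\<forall>k<s ''length'' 0. run reset s ''tokens'' k = T \<and> run reset s ''owner'' k = 0 \<and>
      run reset s ''price'' k = 0"
    unfolding reset_def
  proof (rule Loop_rule[where I = "\<lambda>l t. \<forall>k<l. t ''tokens'' k = T \<and> t ''owner'' k = 0 \<and> t ''price'' k = 0"],
      goal_cases)
    case (4 l t)
    have "t ''input'' 2 = T" using 4(4) ready_header[OF assms(1)] by simp
    then show ?case using 4(2,3) by (auto simp: less_Suc_eq)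
  qed auto
  ultimately show ?thesis
    using ready_header(3)[OF assms(1)] slots_less_L n_less_L
    by (simp add: bidding_def auction.valid_def[OF auction_L])
qed

lemma run_count_tokens:
  assumes "ready s"
  shows "run count_tokens s ''count'' 0 = (\<Sum>i<n. s ''tokens'' i)"
proof -
  define s0 where "s0 = upd s ''count'' 0 0"
  let ?body = "Cond (Less (Var ''i'') voters_exp)
       (Assign ''count'' (Const 0) (Plus (Var ''count'') (Read ''tokens'' (Var ''i'')))) Nop"
  \<comment> \<open>The loop runs on to \<open>L\<close>, past the last voter, hence the minimum
    with \<open>n\<close>.\<close>
  have "run (Loop ''i'' ?body) s0 ''count'' 0 = (\<Sum>i<min (s0 ''length'' 0) n. s ''tokens'' i)"
  proof (rule Loop_rule[where I = "\<lambda>k t. t ''count'' 0 = (\<Sum>i<min k n. s ''tokens'' i)"], goal_cases)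
    case (4 k t)
    have "t ''input'' 0 = n" "t ''tokens'' = s ''tokens''"
      using 4(4) ready_header[OF assms] by (simp_all add: s0_def)
    then show ?case using 4(2,3) by (cases "k < n") (simp_all add: min_def not_less)
  qed (auto simp: s0_def)
  then show ?thesis
    using ready_header(3)[OF assms] n_less_L by (simp add: count_tokens_def s0_def min_def)
qed

lemma run_count_followers:
  assumes "ready s" "s ''h'' 0 < n"
  shows "run count_followers s ''count'' 0 = T * card {i. i < n \<and> (\<forall>j<T. compatible (s ''h'' 0) i j)}"
proof -
  define h where "h = s ''h'' 0"
  define s0 where "s0 = upd s ''count'' 0 0"
  define C where "C i \<longleftrightarrow> (\<forall>j<T. compatible h i j)" for i
  let ?inner = "Loop ''j'' (Cond (And (Less (Var ''j'') rounds_exp) (Neg (compatible_exp (Var ''j''))))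
          (Assign ''conflict'' (Const 0) (Const 1)) Nop)"
  let ?body = "Cond (Less (Var ''i'') voters_exp)
       (Assign ''conflict'' (Const 0) (Const 0) ;; ?inner ;;
        Cond (Var ''conflict'') Nop (Assign ''count'' (Const 0) (Plus (Var ''count'') rounds_exp)))
       Nop"
  have inner: "run ?inner r ''conflict'' 0 = 0 \<longleftrightarrow> C (r ''i'' 0)"
    if "ready r" "r ''h'' 0 = h" "r ''i'' 0 < n" "r ''conflict'' 0 = 0" for r
  proof -
    have "run ?inner r ''conflict'' 0 = 0 \<longleftrightarrow> (\<forall>j<r ''length'' 0. j < T \<longrightarrow> compatible h (r ''i'' 0) j)"
    proof (rule Loop_rule[where I = "\<lambda>k t. t ''conflict'' 0 = 0 \<longleftrightarrow> (\<forall>j<k. j < T \<longrightarrow> compatible h (r ''i'' 0) j)"],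
        goal_cases)
      case (4 k t)
      have "t z = r z" if "z \<notin> {''j'', ''conflict''}" for z
        using 4(4)[rule_format, of z] that by auto
      then have t: "ready t" "t ''h'' 0 = h" "t ''i'' 0 = r ''i'' 0"
        using ready_frame[OF that(1), of t] that(2) by auto
      have "holds (compatible_exp (Var ''j'')) t \<longleftrightarrow> compatible h (r ''i'' 0) k" if "k < T"
        using holds_compatible_exp[OF t(1), of "Var ''j''"] t assms(2) \<open>r ''i'' 0 < n\<close> that 4(3)
        by (simp add: h_def)
      then show ?case
        using 4(2,3) ready_header(2)[OF t(1)] by (cases "k < T") (auto simp: less_Suc_eq)
    qed (use that in auto)
    then show ?thesis using ready_header(3)[OF that(1)] T_less_L by (auto simp: C_def)
  qed
  have "run (Loop ''i'' ?body) s0 ''count'' 0 = T * card {i. i < s0 ''length'' 0 \<and> i < n \<and> C i}"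
  proof (rule Loop_rule[where I = "\<lambda>k t. t ''count'' 0 = T * card {i. i < k \<and> i < n \<and> C i}"], goal_cases)
    case (4 k t)
    define r where "r = upd t ''conflict'' 0 0"
    have fr: "t z = s z" if "z \<notin> {''i'', ''j'', ''conflict'', ''count''}" for z
      using 4(4)[rule_format, of z] that by (auto simp: s0_def)
    have "ready t" by (rule ready_frame[OF assms(1)], rule fr) auto
    then have r: "ready r" "r ''h'' 0 = h" "r ''i'' 0 = k" "r ''conflict'' 0 = 0"
      using 4(3) fr by (simp_all add: r_def h_def ready_upd)
    define q where "q = run ?inner r"
    have q: "q ''input'' 2 = T" "q ''count'' 0 = t ''count'' 0"
      using ready_header[OF r(1)] by (simp_all add: q_def run_frame r_def del: run.simps)
    have "t ''input'' 0 = n" using ready_header[OF r(1)] by (simp add: r_def)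
    then have body: "run ?body t =
        (if k < n then if q ''conflict'' 0 = 0 then upd q ''count'' 0 (t ''count'' 0 + T) else q else t)"
      using 4(3) q by (simp add: q_def r_def del: run.simps(5))
    have conflict: "q ''conflict'' 0 = 0 \<longleftrightarrow> C k" if "k < n"
      using inner[OF r(1,2) _ r(4)] r(3) that unfolding q_def by simp
    show ?case
    proof (cases "k < n \<and> C k")
      case True
      then have "{i. i < Suc k \<and> i < n \<and> C i} = insert k {i. i < k \<and> i < n \<and> C i}"
        by (auto simp: less_Suc_eq)
      then show ?thesis unfolding body using True 4(2) conflict by simp
    next
      case False
      then have "{i. i < Suc k \<and> i < n \<and> C i} = {i. i < k \<and> i < n \<and> C i}"
        by (auto simp: less_Suc_eq)
      moreover have "run ?body t ''count'' 0 = t ''count'' 0"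
        unfolding body using False conflict q(2) by auto
      ultimately show ?thesis using 4(2) by (simp only:)
    qed
  qed (auto simp: s0_def)
  moreover have "{i. i < s0 ''length'' 0 \<and> i < n \<and> C i} = {i. i < n \<and> C i}"
    using ready_header(3)[OF assms(1)] n_less_L by (auto simp: s0_def)
  ultimately show ?thesis by (simp add: count_followers_def s0_def C_def h_def)
qed

lemma run_for_each_voter:
  assumes proper: "proper (for_each_voter p)"
    and writes: "writes p \<inter> (static \<union> {''output'', ''h''}) = {}"
    and p: "\<And>s. ready s \<Longrightarrow> s ''h'' 0 < n \<Longrightarrow> run p s ''count'' 0 < n \<longleftrightarrow> Q (s ''h'' 0)"
  shows "run (for_each_voter p) (initial_state (encode_election E)) ''output'' 0 \<noteq> 0 \<longleftrightarrow> (\<forall>h<n. Q h)"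
proof -
  define s where "s = upd (run prepare (initial_state (encode_election E))) ''output'' 0 1"
  have rs: "ready s"
    unfolding s_def by (rule ready_frame[OF ready_prepare]) auto
  let ?body = "Cond (Less (Var ''h'') voters_exp)
       (p ;; Cond (Less (Var ''count'') voters_exp) Nop (Assign ''output'' (Const 0) (Const 0))) Nop"
  have "run (Loop ''h'' ?body) s ''output'' 0 \<noteq> 0 \<longleftrightarrow> (\<forall>h<s ''length'' 0. h < n \<longrightarrow> Q h)"
  \<comment> \<open>\<open>output\<close> starts at \<open>1\<close> and, once cleared by a
    violating \<open>h\<close>, is never set again.\<close>
  proof (rule Loop_rule[where I = "\<lambda>k t. t ''output'' 0 \<noteq> 0 \<longleftrightarrow> (\<forall>h<k. h < n \<longrightarrow> Q h)"], goal_cases)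
    case (4 k t)
    have "t z = s z" if "z \<in> static" for z
      using 4(4)[rule_format, of z] that writes by auto
    then have t: "ready t" using ready_frame[OF rs] by blast
    have "run p t ''input'' 0 = n" "run p t ''output'' = t ''output''"
      using ready_header[OF t] writes by (auto simp: run_frame)
    then show ?case
      using 4(2,3) p[OF t] ready_header[OF t] by (auto simp: less_Suc_eq)
  qed (use proper in \<open>auto simp: for_each_voter_def s_def\<close>)
  then show ?thesis
    using ready_header(3)[OF rs] n_less_L by (auto simp: for_each_voter_def s_def)
qed

lemma run_wJR_verifier:
  "run wJR_verifier (initial_state (encode_election E)) ''output'' 0 \<noteq> 0 \<longleftrightarrow> all_rank_wJR n m T P W"
  unfolding all_rank_wJR_iff wJR_verifier_def
proof (rule run_for_each_voter)
  show "proper (for_each_voter count_followers)"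
    using proper_verifiers by (simp add: wJR_verifier_def)
  show "writes count_followers \<inter> (static \<union> {''output'', ''h''}) = {}"
    by (simp add: count_followers_def)
qed (simp add: run_count_followers)

lemma run_wPJR_verifier:
  "run wPJR_verifier (initial_state (encode_election E)) ''output'' 0 \<noteq> 0 \<longleftrightarrow> all_rank_wPJR n m T P W"
  unfolding all_rank_wPJR_iff wPJR_verifier_def
proof (rule run_for_each_voter)
  let ?p = "reset ;; Loop ''y'' (Loop ''z'' sweep) ;; count_tokens"
  show "proper (for_each_voter ?p)"
    using proper_verifiers by (simp add: wPJR_verifier_def)
  show "writes ?p \<inter> (static \<union> {''output'', ''h''}) = {}"
    by (simp add: reset_def writes_sweep writes_attempt count_tokens_def)
  fix s assume s: "ready s" "s ''h'' 0 < n"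
  define h where "h = s ''h'' 0"
  define t where "t = run (Loop ''y'' (Loop ''z'' sweep)) (run reset s)"
  have t: "bidding h t" "stuck h t"
    using run_sweeps[OF run_reset] s by (simp_all add: t_def h_def)
  have count: "run ?p s ''count'' 0 = (\<Sum>i<n. t ''tokens'' i)"
    using run_count_tokens[of t] t(1) by (simp add: t_def bidding_def del: run.simps(5))
  \<comment> \<open>With misfits as adjacency, the neighbours of \<open>S\<close> are the rounds in
    which some member does not fit the side of \<open>h\<close>, so Hall violators are exactly the
    violations in \<open>all_rank_wPJR_iff\<close>.\<close>
  have violator: "(\<exists>S\<subseteq>{..<n}. n * (card {j. j < T \<and> (\<exists>i\<in>S. \<not> compatible h i j)} + 1) \<le> T * card S)
      \<longleftrightarrow> n \<le> (\<Sum>i<n. t ''tokens'' i)"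
    using auction.violator_iff[OF auction_L, of "\<lambda>i j. \<not> compatible h i j" "t ''tokens''" "t ''owner''"
        "t ''price''"] t by (simp add: bidding_def stuck_def)
  have "run ?p s ''count'' 0 < n \<longleftrightarrow> \<not> n \<le> (\<Sum>i<n. t ''tokens'' i)"
    by (simp only: count not_le)
  also have "\<dots> \<longleftrightarrow>
      (\<forall>S\<subseteq>{..<n}. T * card S < n * (card {j. j < T \<and> (\<exists>i\<in>S. \<not> compatible h i j)} + 1))"
    unfolding violator[symmetric] by (meson not_le)
  finally show "run ?p s ''count'' 0 < n \<longleftrightarrow>
      (\<forall>S\<subseteq>{..<n}. T * card S < n * (card {j. j < T \<and> (\<exists>i\<in>S. \<not> compatible (s ''h'' 0) i j)} + 1))"
    unfolding h_def .
qed

end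

theorem theorem6p4:
  shows "poly_time_decidable encode_election single_peaked_election
           (\<lambda>E. all_rank_wJR (num_voters E) (num_cands E) (num_rounds E) (prof E) (winners E))
       \<and> poly_time_decidable encode_election single_peaked_election
           (\<lambda>E. all_rank_wPJR (num_voters E) (num_cands E) (num_rounds E) (prof E) (winners E))"
proof (intro conjI poly_time_decidable_run)
  fix E assume "single_peaked_election E"
  then interpret single_peaked_instance E "num_voters E" "num_cands E" "num_rounds E" "prof E" "winners E"
    by unfold_locales
  show "run wJR_verifier (initial_state (encode_election E)) ''output'' 0 \<noteq> 0 \<longleftrightarrow>
      all_rank_wJR (num_voters E) (num_cands E) (num_rounds E) (prof E) (winners E)"
    by (rule run_wJR_verifier)
  show "run wPJR_verifier (initial_state (encode_election E)) ''output'' 0 \<noteq> 0 \<longleftrightarrow>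
      all_rank_wPJR (num_voters E) (num_cands E) (num_rounds E) (prof E) (winners E)"
    by (rule run_wPJR_verifier)
qed (fact proper_verifiers)+

end
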